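(* Let $p$ be a prime. Suppose that all Noetherian weakly F-regular local $\mathbb{F}_p$-algebras are semi F-regular. Then weak F-regularity is equivalent to F-regularity for all Noetherian $\mathbb{F}_p$-algebras.
   Context: Rings are commutative with $1$. For a Noetherian ring $R$ of characteristic $p$, $R^\circ$ is the complement of the union of the minimal primes of $R$; the tight closure $I^*$ of an ideal $I$ is the set of $z\in R$ for which there are $c\in R^\circ$ and a power $q_0$ of $p$ with $cz^q\in I^{[q]}$ for all powers $q\ge q_0$ of $p$, where $I^{[q]}$ is the ideal generated by $q$-th powers of elements of $I$. $R$ is weakly F-regular if $I^*=I$ for every ideal $I$ of $R$. $R$ is F-regular if every localization of $R$ at a multiplicative set is weakly F-regular. $R$ is semi F-regular if $R_f$ is weakly F-regular for every $f\in R$; equivalently, for every affine open $U\subseteq\operatorname{Spec}R$, every ideal of $\mathcal{O}_{\operatorname{Spec}R}(U)$ is tightly closed. *)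

theory Defs
  imports "HOL-Computational_Algebra.Primes" "HOL-Algebra.Ring_Divisibility"
begin

section \<open>Localization at a multiplicative set\<close>

text \<open>
  \<open>S\<close> is meant to be a submonoid of the multiplicative monoid of \<open>R\<close>. It may contain zero divisors
  (hence the factor \<open>u\<close> below) and even zero, in which case the localization is the zero ring.
\<close>

definition frac_rel :: "('a, 'b) ring_scheme \<Rightarrow> 'a set \<Rightarrow> (('a \<times> 'a) \<times> ('a \<times> 'a)) set" where
  "frac_rel R S = {((a, s), (b, t)). a \<in> carrier R \<and> s \<in> S \<and> b \<in> carrier R \<and> t \<in> S \<and>
     (\<exists>u\<in>S. u \<otimes>\<^bsub>R\<^esub> (t \<otimes>\<^bsub>R\<^esub> a) = u \<otimes>\<^bsub>R\<^esub> (s \<otimes>\<^bsub>R\<^esub> b))}"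

definition fraction :: "('a, 'b) ring_scheme \<Rightarrow> 'a set \<Rightarrow> 'a \<Rightarrow> 'a \<Rightarrow> ('a \<times> 'a) set" where
  "fraction R S a s = frac_rel R S `` {(a, s)}"

text \<open>
  Sum and product of two classes are given as unions over all choices of representatives. All the
  classes united are equal, see the lemmas \<open>localization_mult\<close> and \<open>localization_add\<close> below.
\<close>

definition localization :: "('a, 'b) ring_scheme \<Rightarrow> 'a set \<Rightarrow> ('a \<times> 'a) set ring" where
  "localization R S =
     \<lparr>carrier = (carrier R \<times> S) // frac_rel R S,
      monoid.mult = (\<lambda>X Y. \<Union>(a, s)\<in>X. \<Union>(b, t)\<in>Y. fraction R S (a \<otimes>\<^bsub>R\<^esub> b) (s \<otimes>\<^bsub>R\<^esub> t)),
      one = fraction R S \<one>\<^bsub>R\<^esub> \<one>\<^bsub>R\<^esub>,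
      zero = fraction R S \<zero>\<^bsub>R\<^esub> \<one>\<^bsub>R\<^esub>,
      add = (\<lambda>X Y. \<Union>(a, s)\<in>X. \<Union>(b, t)\<in>Y.
        fraction R S ((t \<otimes>\<^bsub>R\<^esub> a) \<oplus>\<^bsub>R\<^esub> (s \<otimes>\<^bsub>R\<^esub> b)) (s \<otimes>\<^bsub>R\<^esub> t))\<rparr>"

locale cring_mult_set = cring R + submonoid S R for R (structure) and S
begin

lemma S_carrier: "s \<in> S \<Longrightarrow> s \<in> carrier R"
  using subset by blast

lemma frac_rel_iff:
  "((a, s), (b, t)) \<in> frac_rel R S \<longleftrightarrow> a \<in> carrier R \<and> s \<in> S \<and> b \<in> carrier R \<and> t \<in> S \<and>
     (\<exists>u\<in>S. u \<otimes> (t \<otimes> a) = u \<otimes> (s \<otimes> b))"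
  by (simp add: frac_rel_def)

lemma equiv_frac_rel: "equiv (carrier R \<times> S) (frac_rel R S)"
proof (rule equivI)
  show "frac_rel R S \<subseteq> (carrier R \<times> S) \<times> (carrier R \<times> S)"
    by (auto simp: frac_rel_def)
  show "refl_on (carrier R \<times> S) (frac_rel R S)"
    by (auto simp: refl_on_def frac_rel_def)
  show "sym (frac_rel R S)"
    by (auto simp: sym_def frac_rel_def) metis
  show "trans (frac_rel R S)"
  proof (rule transI)
    fix x y z assume xy: "(x, y) \<in> frac_rel R S" and yz: "(y, z) \<in> frac_rel R S"
    obtain a s b t c r where [simp]: "x = (a, s)" "y = (b, t)" "z = (c, r)"
      by (cases x, cases y, cases z)
    from xy yz obtain u v where
      car: "a \<in> carrier R" "b \<in> carrier R" "c \<in> carrier R" and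
      S: "s \<in> S" "t \<in> S" "r \<in> S" "u \<in> S" "v \<in> S" and
      u: "u \<otimes> (t \<otimes> a) = u \<otimes> (s \<otimes> b)" and v: "v \<otimes> (r \<otimes> b) = v \<otimes> (t \<otimes> c)"
      by (auto simp: frac_rel_iff)
    note car = car S(1-5)[THEN S_carrier]
    have "(u \<otimes> v \<otimes> t) \<otimes> (r \<otimes> a) = (v \<otimes> r) \<otimes> (u \<otimes> (t \<otimes> a))"
      using car by algebra
    also have "\<dots> = (u \<otimes> s) \<otimes> (v \<otimes> (r \<otimes> b))"
      unfolding u using car by algebra
    also have "\<dots> = (u \<otimes> v \<otimes> t) \<otimes> (s \<otimes> c)"
      unfolding v using car by algebra
    finally show "(x, z) \<in> frac_rel R S"
      using car S by (auto simp: frac_rel_iff)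
  qed
qed

lemma fraction_eq_iff:
  assumes "a \<in> carrier R" "s \<in> S" "b \<in> carrier R" "t \<in> S"
  shows "fraction R S a s = fraction R S b t \<longleftrightarrow> (\<exists>u\<in>S. u \<otimes> (t \<otimes> a) = u \<otimes> (s \<otimes> b))"
  using assms eq_equiv_class_iff[OF equiv_frac_rel, of "(a, s)" "(b, t)"]
  by (simp add: fraction_def frac_rel_iff)

lemma carrier_localization:
  "carrier (localization R S) = {fraction R S a s | a s. a \<in> carrier R \<and> s \<in> S}"
  by (auto simp: localization_def quotient_def fraction_def)

lemma fraction_in_carrier:
  "a \<in> carrier R \<Longrightarrow> s \<in> S \<Longrightarrow> fraction R S a s \<in> carrier (localization R S)"
  by (auto simp: carrier_localization)

lemma one_localization: "\<one>\<^bsub>localization R S\<^esub> = fraction R S \<one> \<one>"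
  and zero_localization: "\<zero>\<^bsub>localization R S\<^esub> = fraction R S \<zero> \<one>"
  by (simp_all add: localization_def)

lemma UN_fraction_const:
  assumes "a \<in> carrier R" "s \<in> S" "b \<in> carrier R" "t \<in> S"
    and "\<And>a' s' b' t'. ((a, s), (a', s')) \<in> frac_rel R S \<Longrightarrow> ((b, t), (b', t')) \<in> frac_rel R S
           \<Longrightarrow> g a' s' b' t' = g a s b t"
  shows "(\<Union>(a, s)\<in>fraction R S a s. \<Union>(b, t)\<in>fraction R S b t. g a s b t) = g a s b t"
proof -
  have "((a, s), (a, s)) \<in> frac_rel R S" "((b, t), (b, t)) \<in> frac_rel R S"
    using assms(1-4) by (auto simp: frac_rel_iff)
  then show ?thesis
    using assms(5) unfolding fraction_def by fast
qed

lemma localization_mult: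
  assumes "a \<in> carrier R" "s \<in> S" "b \<in> carrier R" "t \<in> S"
  shows "fraction R S a s \<otimes>\<^bsub>localization R S\<^esub> fraction R S b t = fraction R S (a \<otimes> b) (s \<otimes> t)"
proof -
  have "fraction R S (a' \<otimes> b') (s' \<otimes> t') = fraction R S (a \<otimes> b) (s \<otimes> t)"
    if "((a, s), (a', s')) \<in> frac_rel R S" "((b, t), (b', t')) \<in> frac_rel R S" for a' s' b' t'
  proof -
    from that obtain u v where
      car: "a' \<in> carrier R" "b' \<in> carrier R" and S: "s' \<in> S" "t' \<in> S" "u \<in> S" "v \<in> S" and
      u: "u \<otimes> (s' \<otimes> a) = u \<otimes> (s \<otimes> a')" and v: "v \<otimes> (t' \<otimes> b) = v \<otimes> (t \<otimes> b')"
      by (auto simp: frac_rel_iff)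
    note car = car S[THEN S_carrier] assms(1,3) assms(2,4)[THEN S_carrier]
    have "(u \<otimes> v) \<otimes> ((s \<otimes> t) \<otimes> (a' \<otimes> b')) = (u \<otimes> (s \<otimes> a')) \<otimes> (v \<otimes> (t \<otimes> b'))"
      using car by algebra
    also have "\<dots> = (u \<otimes> v) \<otimes> ((s' \<otimes> t') \<otimes> (a \<otimes> b))"
      unfolding u[symmetric] v[symmetric] using car by algebra
    finally show ?thesis
      using car S assms by (subst fraction_eq_iff) auto
  qed
  then show ?thesis
    using UN_fraction_const[OF assms, of "\<lambda>a s b t. fraction R S (a \<otimes> b) (s \<otimes> t)"]
    by (simp add: localization_def)
qed

lemma localization_add:
  assumes "a \<in> carrier R" "s \<in> S" "b \<in> carrier R" "t \<in> S"
  shows "fraction R S a s \<oplus>\<^bsub>localization R S\<^esub> fraction R S b t = fraction R S ((t \<otimes> a) \<oplus> (s \<otimes> b)) (s \<otimes> t)"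
proof -
  have "fraction R S ((t' \<otimes> a') \<oplus> (s' \<otimes> b')) (s' \<otimes> t') = fraction R S ((t \<otimes> a) \<oplus> (s \<otimes> b)) (s \<otimes> t)"
    if "((a, s), (a', s')) \<in> frac_rel R S" "((b, t), (b', t')) \<in> frac_rel R S" for a' s' b' t'
  proof -
    from that obtain u v where
      car: "a' \<in> carrier R" "b' \<in> carrier R" and S: "s' \<in> S" "t' \<in> S" "u \<in> S" "v \<in> S" and
      u: "u \<otimes> (s' \<otimes> a) = u \<otimes> (s \<otimes> a')" and v: "v \<otimes> (t' \<otimes> b) = v \<otimes> (t \<otimes> b')"
      by (auto simp: frac_rel_iff)
    note car = car S[THEN S_carrier] assms(1,3) assms(2,4)[THEN S_carrier]
    have "(u \<otimes> v) \<otimes> ((s \<otimes> t) \<otimes> ((t' \<otimes> a') \<oplus> (s' \<otimes> b')))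
        = (v \<otimes> t \<otimes> t') \<otimes> (u \<otimes> (s \<otimes> a')) \<oplus> (u \<otimes> s \<otimes> s') \<otimes> (v \<otimes> (t \<otimes> b'))"
      using car by algebra
    also have "\<dots> = (u \<otimes> v) \<otimes> ((s' \<otimes> t') \<otimes> ((t \<otimes> a) \<oplus> (s \<otimes> b)))"
      unfolding u[symmetric] v[symmetric] using car by algebra
    finally show ?thesis
      using car S assms by (subst fraction_eq_iff) auto
  qed
  then show ?thesis
    using UN_fraction_const[OF assms, of "\<lambda>a s b t. fraction R S ((t \<otimes> a) \<oplus> (s \<otimes> b)) (s \<otimes> t)"]
    by (simp add: localization_def)
qed

lemma fraction_eqI:
  assumes "a \<in> carrier R" "s \<in> S" "b \<in> carrier R" "t \<in> S" "t \<otimes> a = s \<otimes> b"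
  shows "fraction R S a s = fraction R S b t"
  using assms by (subst fraction_eq_iff) auto

lemma cring_localization: "cring (localization R S)"
proof (rule cringI)
  let ?L = "localization R S"
  note [simp] = one_localization zero_localization fraction_in_carrier localization_mult
    localization_add S_carrier
  have ex: "\<exists>a s. a \<in> carrier R \<and> s \<in> S \<and> x = fraction R S a s" if "x \<in> carrier ?L" for x
    using that by (auto simp: carrier_localization)
  show "abelian_group ?L"
  proof (rule abelian_groupI)
    fix x y assume x: "x \<in> carrier ?L" and y: "y \<in> carrier ?L"
    obtain a s b t where [simp]: "x = fraction R S a s" "y = fraction R S b t"
      and car [simp]: "a \<in> carrier R" "s \<in> S" "b \<in> carrier R" "t \<in> S"
      using ex[OF x] ex[OF y] by blast
    note car' = car car(2,4)[THEN S_carrier]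
    show "x \<oplus>\<^bsub>?L\<^esub> y \<in> carrier ?L" by simp
    show "x \<oplus>\<^bsub>?L\<^esub> y = y \<oplus>\<^bsub>?L\<^esub> x"
      by (simp, rule fraction_eqI) (simp_all, use car' in algebra)
    show "\<zero>\<^bsub>?L\<^esub> \<oplus>\<^bsub>?L\<^esub> x = x"
      by (simp)
    show "\<exists>y\<in>carrier ?L. y \<oplus>\<^bsub>?L\<^esub> x = \<zero>\<^bsub>?L\<^esub>"
    proof
      show "fraction R S (\<ominus> a) s \<oplus>\<^bsub>?L\<^esub> x = \<zero>\<^bsub>?L\<^esub>"
        by (simp, rule fraction_eqI) (simp_all, use car' in algebra)
    qed simp
    fix z assume z: "z \<in> carrier ?L"
    obtain c r where [simp]: "z = fraction R S c r" "c \<in> carrier R" "r \<in> S"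
      using ex[OF z] by blast
    show "x \<oplus>\<^bsub>?L\<^esub> y \<oplus>\<^bsub>?L\<^esub> z = x \<oplus>\<^bsub>?L\<^esub> (y \<oplus>\<^bsub>?L\<^esub> z)"
      by (simp, rule fraction_eqI)
        (simp_all, use car' \<open>c \<in> carrier R\<close> \<open>r \<in> S\<close>[THEN S_carrier] in algebra)
  qed simp
  show "comm_monoid ?L"
  proof (rule comm_monoidI)
    fix x y assume x: "x \<in> carrier ?L" and y: "y \<in> carrier ?L"
    obtain a s b t where [simp]: "x = fraction R S a s" "y = fraction R S b t"
      "a \<in> carrier R" "s \<in> S" "b \<in> carrier R" "t \<in> S"
      using ex[OF x] ex[OF y] by blast
    show "x \<otimes>\<^bsub>?L\<^esub> y \<in> carrier ?L" by simp
    show "x \<otimes>\<^bsub>?L\<^esub> y = y \<otimes>\<^bsub>?L\<^esub> x"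
      by (simp add: m_comm)
    show "\<one>\<^bsub>?L\<^esub> \<otimes>\<^bsub>?L\<^esub> x = x" by simp
    fix z assume z: "z \<in> carrier ?L"
    obtain c r where [simp]: "z = fraction R S c r" "c \<in> carrier R" "r \<in> S"
      using ex[OF z] by blast
    show "x \<otimes>\<^bsub>?L\<^esub> y \<otimes>\<^bsub>?L\<^esub> z = x \<otimes>\<^bsub>?L\<^esub> (y \<otimes>\<^bsub>?L\<^esub> z)"
      by (simp add: m_assoc)
  qed simp
  fix x y z assume x: "x \<in> carrier ?L" and y: "y \<in> carrier ?L" and z: "z \<in> carrier ?L"
  obtain a s b t c r where [simp]: "x = fraction R S a s" "y = fraction R S b t" "z = fraction R S c r"
    and car [simp]: "a \<in> carrier R" "b \<in> carrier R" "c \<in> carrier R" "s \<in> S" "t \<in> S" "r \<in> S"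
    using ex[OF x] ex[OF y] ex[OF z] by blast
  note car' = car(1-3) car(4-6)[THEN S_carrier]
  show "(x \<oplus>\<^bsub>?L\<^esub> y) \<otimes>\<^bsub>?L\<^esub> z = x \<otimes>\<^bsub>?L\<^esub> z \<oplus>\<^bsub>?L\<^esub> y \<otimes>\<^bsub>?L\<^esub> z"
    by (simp, rule fraction_eqI) (simp_all, use car' in algebra)
qed

end

section \<open>Rings of characteristic \<open>p\<close>\<close>

text \<open>
  A ring has at most one \<open>\<bbbF>\<^sub>p\<close>-algebra structure, and it has one iff \<open>p\<close> times its unit vanishes.
  The zero ring is an \<open>\<bbbF>\<^sub>p\<close>-algebra.
\<close>

definition Fp_algebra :: "nat \<Rightarrow> ('a, 'b) ring_scheme \<Rightarrow> bool" where
  "Fp_algebra p R \<longleftrightarrow> cring R \<and> [p] \<cdot>\<^bsub>R\<^esub> \<one>\<^bsub>R\<^esub> = \<zero>\<^bsub>R\<^esub>"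

definition local_ring :: "('a, 'b) ring_scheme \<Rightarrow> bool" where
  "local_ring R \<longleftrightarrow> cring R \<and> (\<exists>!M. maximalideal M R)"

definition minimal_prime :: "'a set \<Rightarrow> ('a, 'b) ring_scheme \<Rightarrow> bool" where
  "minimal_prime P R \<longleftrightarrow> primeideal P R \<and> (\<forall>Q. primeideal Q R \<longrightarrow> Q \<subseteq> P \<longrightarrow> Q = P)"

definition ring_circ :: "('a, 'b) ring_scheme \<Rightarrow> 'a set" where
  "ring_circ R = carrier R - \<Union>{P. minimal_prime P R}"

definition bracket_power :: "('a, 'b) ring_scheme \<Rightarrow> 'a set \<Rightarrow> nat \<Rightarrow> 'a set" where
  "bracket_power R I q = Idl\<^bsub>R\<^esub> {x [^]\<^bsub>R\<^esub> q | x. x \<in> I}"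

definition tight_closure :: "nat \<Rightarrow> ('a, 'b) ring_scheme \<Rightarrow> 'a set \<Rightarrow> 'a set" where
  "tight_closure p R I = {z \<in> carrier R. \<exists>c\<in>ring_circ R. \<exists>e\<^sub>0::nat. \<forall>e\<ge>e\<^sub>0.
     c \<otimes>\<^bsub>R\<^esub> (z [^]\<^bsub>R\<^esub> (p ^ e)) \<in> bracket_power R I (p ^ e)}"

definition weakly_F_regular :: "nat \<Rightarrow> ('a, 'b) ring_scheme \<Rightarrow> bool" where
  "weakly_F_regular p R \<longleftrightarrow> (\<forall>I. ideal I R \<longrightarrow> tight_closure p R I = I)"

definition F_regular :: "nat \<Rightarrow> ('a, 'b) ring_scheme \<Rightarrow> bool" where
  "F_regular p R \<longleftrightarrow> (\<forall>S. submonoid S R \<longrightarrow> weakly_F_regular p (localization R S))"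

definition semi_F_regular :: "nat \<Rightarrow> ('a, 'b) ring_scheme \<Rightarrow> bool" where
  "semi_F_regular p R \<longleftrightarrow>
     (\<forall>f\<in>carrier R. weakly_F_regular p (localization R {f [^]\<^bsub>R\<^esub> n | n::nat. True}))"

end

theory Submission
  imports Defs "HOL-Algebra.Weak_Morphisms" "HOL-Library.Equipollence"
begin

text \<open>
  An F-regular ring is weakly F-regular, as it is its own localization at \<open>{1}\<close>. For the converse let
  \<open>R\<close> be Noetherian and weakly F-regular. Nilpotents lie in the tight closure of \<open>0\<close>, so \<open>R\<close> is
  reduced, as are its localizations, and in all these rings \<open>R\<^sup>\<circ>\<close> is the set of nonzerodivisors
  (\<open>ring_circ_reduced\<close>). Weak F-regularity of \<open>S\<inverse>R\<close> then becomes a statement about ideals of \<open>R\<close>: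
  if for all large \<open>q\<close> some \<open>s \<in> S\<close>, which may depend on \<open>q\<close>, satisfies \<open>s c z\<^sup>q \<in> I\<^sup>[\<^sup>q\<^sup>]\<close>, then
  \<open>s z \<in> I\<close> for some \<open>s \<in> S\<close> (\<open>weakly_F_regular_at\<close>, \<open>weakly_F_regular_target_iff\<close>). If this holds
  whenever \<open>S\<close> is the complement of a prime ideal, it holds for every \<open>S\<close>: otherwise a prime that
  contains \<open>I : z\<close> and avoids \<open>S\<close> would contradict it.

  So it remains to treat the local rings \<open>R\<^sub>P\<close>. There are two tools.

  \<^item> If \<open>P\<close> becomes a maximal ideal of \<open>S\<inverse>R\<close>, weak F-regularity passes from \<open>S\<inverse>R\<close> to \<open>R\<^sub>P\<close>
    (\<open>weakly_F_regular_at_maximal_prime\<close>). After enlarging \<open>I\<close>, every element of \<open>P\<close> is nilpotent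
    modulo \<open>I\<close>, so what lies outside \<open>P\<close> becomes a unit of \<open>S\<inverse>R\<close> modulo every \<open>I\<^sup>[\<^sup>q\<^sup>]\<close>.

  \<^item> If \<open>R\<^sub>Q\<close> is weakly F-regular, the assumption on local rings gives the same for \<open>(R\<^sub>Q)\<^sub>x\<close>, for
    every \<open>x\<close> (\<open>weakly_F_regular_at_invert_element\<close>).

  The first tool with \<open>S = {1}\<close> handles the maximal ideals. Let \<open>P\<close> be a prime that is maximal among
  those at which weak F-regularity fails. Choose \<open>x \<notin> P\<close> with \<open>P + (x)\<close> proper and a prime \<open>Q\<close>
  minimal over \<open>P + (x)\<close>; then \<open>R\<^sub>Q\<close> is weakly F-regular, and so is \<open>(R\<^sub>Q)\<^sub>x\<close>. By Krull's principal
  ideal theorem no prime lies strictly between \<open>P\<close> and \<open>Q\<close>, so \<open>P\<close> is a maximal ideal of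
  \<open>(R\<^sub>Q)\<^sub>x\<close>, and the first tool shows that \<open>R\<^sub>P\<close> is weakly F-regular, a contradiction.

  The assumption speaks of local rings over the same type as \<open>R\<close>, whereas the localization consists
  of sets of pairs. A localization never has larger cardinality than the ring (\<open>target_lepoll\<close>), so
  \<open>R\<^sub>Q\<close> has an isomorphic copy over the type of \<open>R\<close>. For this reason localizations are handled
  through their characteristic properties (\<open>localization_map\<close>).
\<close>

section \<open>Ideals of a Noetherian ring\<close>

locale noetherian_cring = noetherian_ring R + cring R for R (structure)

definition saturation :: "('a, 'b) ring_scheme \<Rightarrow> 'a set \<Rightarrow> 'a set \<Rightarrow> 'a set" where
  "saturation R S I = {a \<in> carrier R. \<exists>s\<in>S. s \<otimes>\<^bsub>R\<^esub> a \<in> I}"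

definition saturated :: "('a, 'b) ring_scheme \<Rightarrow> 'a set \<Rightarrow> 'a set \<Rightarrow> bool" where
  "saturated R S I \<longleftrightarrow> (\<forall>a\<in>carrier R. \<forall>s\<in>S. s \<otimes>\<^bsub>R\<^esub> a \<in> I \<longrightarrow> a \<in> I)"

definition colon :: "('a, 'b) ring_scheme \<Rightarrow> 'a set \<Rightarrow> 'a \<Rightarrow> 'a set" where
  "colon R I a = {r \<in> carrier R. r \<otimes>\<^bsub>R\<^esub> a \<in> I}"

context cring
begin

abbreviation adjoin :: "'a set \<Rightarrow> 'a \<Rightarrow> 'a set" where
  "adjoin I a \<equiv> I <+>\<^bsub>R\<^esub> PIdl a"

lemma ideal_by_closure:
  assumes "I \<subseteq> carrier R" "\<zero> \<in> I"
    and add: "\<And>a b. a \<in> I \<Longrightarrow> b \<in> I \<Longrightarrow> a \<oplus> b \<in> I"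
    and mult: "\<And>r a. r \<in> carrier R \<Longrightarrow> a \<in> I \<Longrightarrow> r \<otimes> a \<in> I"
  shows "ideal I R"
proof (rule idealI)
  show "ring R" by (rule ring_axioms)
  show "subgroup I (add_monoid R)"
  proof (rule add.subgroupI)
    show "I \<subseteq> carrier R" "I \<noteq> {}" using assms(1,2) by auto
    fix a assume a: "a \<in> I"
    then have "a \<in> carrier R" using assms(1) by auto
    then have "\<ominus> a = (\<ominus> \<one>) \<otimes> a" by algebra
    then show "\<ominus> a \<in> I" using mult[of "\<ominus> \<one>" a] a by simp
  qed (rule add)
  fix a x assume a: "a \<in> I" "x \<in> carrier R"
  then show "x \<otimes> a \<in> I" by (rule mult[rotated])
  then show "a \<otimes> x \<in> I" using a assms(1) m_comm[of a x] by auto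
qed

lemma ideal_props:
  assumes "ideal I R"
  shows "I \<subseteq> carrier R" "\<zero> \<in> I" "a \<in> I \<Longrightarrow> b \<in> I \<Longrightarrow> a \<oplus> b \<in> I"
    "r \<in> carrier R \<Longrightarrow> a \<in> I \<Longrightarrow> r \<otimes> a \<in> I"
    "a \<in> I \<Longrightarrow> b \<in> I \<Longrightarrow> a \<ominus> b \<in> I" "a \<in> I \<Longrightarrow> a \<in> carrier R"
proof -
  interpret I: ideal I R by fact
  show "I \<subseteq> carrier R" "\<zero> \<in> I" "a \<in> I \<Longrightarrow> b \<in> I \<Longrightarrow> a \<oplus> b \<in> I"
    "r \<in> carrier R \<Longrightarrow> a \<in> I \<Longrightarrow> r \<otimes> a \<in> I" "a \<in> I \<Longrightarrow> a \<in> carrier R"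
    using I.a_subset I.I_l_closed by auto
  show "a \<in> I \<Longrightarrow> b \<in> I \<Longrightarrow> a \<ominus> b \<in> I"
    by (simp add: a_minus_def)
qed

lemma ideal_cancel_right:
  assumes "ideal I R" "a \<oplus> b \<in> I" "b \<in> I" "a \<in> carrier R"
  shows "a \<in> I"
proof -
  have "b \<in> carrier R" using ideal_props(6)[OF assms(1,3)] .
  then have "a = (a \<oplus> b) \<ominus> b" using assms(4) by algebra
  then show ?thesis using ideal_props(5)[OF assms(1-3)] by simp
qed

lemma ideal_cancel_left:
  assumes "ideal I R" "b \<oplus> a \<in> I" "b \<in> I" "a \<in> carrier R"
  shows "a \<in> I"
  using ideal_cancel_right[OF assms(1) _ assms(3,4)] assms(2,4) ideal_props(6)[OF assms(1,3)]
  by (simp add: a_comm)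

lemma ideal_adjoin: "ideal I R \<Longrightarrow> a \<in> carrier R \<Longrightarrow> ideal (adjoin I a) R"
  by (intro add_ideals cgenideal_ideal)

lemma mem_adjoin_iff:
  "x \<in> adjoin I a \<longleftrightarrow> (\<exists>i\<in>I. \<exists>r\<in>carrier R. x = i \<oplus> r \<otimes> a)"
  unfolding set_add_def' cgenideal_def by blast

lemma subset_adjoin: "ideal I R \<Longrightarrow> a \<in> carrier R \<Longrightarrow> I \<subseteq> adjoin I a"
proof
  fix x assume "ideal I R" "a \<in> carrier R" "x \<in> I"
  then have "x = x \<oplus> \<zero> \<otimes> a" using ideal_props(6)[of I x] by simp
  then show "x \<in> adjoin I a" using \<open>x \<in> I\<close> mem_adjoin_iff by blast
qed

lemma mem_adjoin_self: "ideal I R \<Longrightarrow> a \<in> carrier R \<Longrightarrow> a \<in> adjoin I a"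
  unfolding mem_adjoin_iff by (rule bexI[of _ \<zero>], rule bexI[of _ \<one>]) (auto simp: ideal_props)

lemma adjoin_subset:
  assumes "ideal J R" "I \<subseteq> J" "a \<in> J"
  shows "adjoin I a \<subseteq> J"
proof
  fix x assume "x \<in> adjoin I a"
  then obtain i r where "i \<in> I" "r \<in> carrier R" "x = i \<oplus> r \<otimes> a" unfolding mem_adjoin_iff by blast
  then show "x \<in> J"
    using ideal_props(3)[OF assms(1), of i "r \<otimes> a"] ideal_props(4)[OF assms(1), of r a] assms(2,3) by auto
qed

lemma ideal_colon:
  assumes I: "ideal I R" and a: "a \<in> carrier R"
  shows "ideal (colon R I a) R"
  unfolding colon_def
proof (rule ideal_by_closure)
  fix r s assume "r \<in> {r \<in> carrier R. r \<otimes> a \<in> I}" "s \<in> {r \<in> carrier R. r \<otimes> a \<in> I}"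
  then show "r \<oplus> s \<in> {r \<in> carrier R. r \<otimes> a \<in> I}"
    using ideal_props[OF I] a by (simp add: l_distr)
next
  fix r s assume "r \<in> carrier R" "s \<in> {r \<in> carrier R. r \<otimes> a \<in> I}"
  then show "r \<otimes> s \<in> {r \<in> carrier R. r \<otimes> a \<in> I}"
    using ideal_props[OF I] a by (simp add: m_assoc)
qed (use ideal_props[OF I] a in auto)

lemma prime_props:
  assumes "primeideal P R"
  shows "ideal P R" "\<one> \<notin> P" "a \<in> carrier R \<Longrightarrow> b \<in> carrier R \<Longrightarrow> a \<otimes> b \<in> P \<Longrightarrow> a \<in> P \<or> b \<in> P"
proof -
  interpret P: primeideal P R by fact
  show "ideal P R" by (rule P.is_ideal)
  show "\<one> \<notin> P" using P.one_imp_carrier P.I_notcarr by auto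
  show "a \<in> carrier R \<Longrightarrow> b \<in> carrier R \<Longrightarrow> a \<otimes> b \<in> P \<Longrightarrow> a \<in> P \<or> b \<in> P" by (rule P.I_prime)
qed

lemma prime_by_closure:
  assumes "ideal P R" "\<one> \<notin> P"
    and "\<And>a b. a \<in> carrier R \<Longrightarrow> b \<in> carrier R \<Longrightarrow> a \<otimes> b \<in> P \<Longrightarrow> a \<in> P \<or> b \<in> P"
  shows "primeideal P R"
proof (rule primeidealI)
  show "carrier R \<noteq> P" using assms(2) by auto
qed (use assms is_cring in auto)

lemma prime_power:
  assumes "primeideal P R" "a \<in> carrier R" "a [^] (n::nat) \<in> P"
  shows "a \<in> P"
  using assms(3)
proof (induction n)
  case 0 then show ?case using prime_props(2)[OF assms(1)] by simp
next
  case (Suc n) then show ?case using prime_props(3)[OF assms(1), of "a [^] n" a] assms(2) by auto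
qed

lemma submonoid_prime_complement:
  assumes "primeideal P R"
  shows "submonoid (carrier R - P) R"
  using prime_props[OF assms] by unfold_locales auto

lemma submonoid_times_powers:
  assumes "submonoid S R" "x \<in> carrier R"
  shows "submonoid {t \<otimes> x [^] (n::nat) | t n. t \<in> S} R"
proof -
  interpret S: submonoid S R by fact
  show ?thesis
  proof
    fix a b assume "a \<in> {t \<otimes> x [^] (n::nat) | t n. t \<in> S}" "b \<in> {t \<otimes> x [^] (n::nat) | t n. t \<in> S}"
    then obtain t n u m where e: "a = t \<otimes> x [^] (n::nat)" "t \<in> S" "b = u \<otimes> x [^] (m::nat)" "u \<in> S"
      by blast
    have c: "t \<in> carrier R" "u \<in> carrier R" "x [^] n \<in> carrier R" "x [^] m \<in> carrier R"
      using e assms(2) by auto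
    have "a \<otimes> b = (t \<otimes> u) \<otimes> (x [^] n \<otimes> x [^] m)"
      unfolding e using c by algebra
    also have "x [^] n \<otimes> x [^] m = x [^] (n + m)" using assms(2) by (simp add: nat_pow_mult)
    finally show "a \<otimes> b \<in> {t \<otimes> x [^] (n::nat) | t n. t \<in> S}" using e by auto
  next
    have "\<one> = \<one> \<otimes> x [^] (0::nat)" by simp
    then show "\<one> \<in> {t \<otimes> x [^] (n::nat) | t n. t \<in> S}" using S.one_closed by blast
  qed (use assms in auto)
qed

lemma submonoid_powers:
  assumes "x \<in> carrier R"
  shows "submonoid {x [^] (n::nat) | n. True} R"
proof
  show "\<one> \<in> {x [^] (n::nat) | n. True}" using nat_pow_0[of x] by (metis (mono_tags) mem_Collect_eq)
qed (use assms nat_pow_mult in auto)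

lemma ideal_saturation:
  assumes "submonoid S R" "ideal I R"
  shows "ideal (saturation R S I) R"
  unfolding saturation_def
proof (rule ideal_by_closure)
  interpret S: submonoid S R by fact
  note I = ideal_props[OF assms(2)]
  have "\<exists>s\<in>S. s \<otimes> \<zero> \<in> I" by (rule bexI[OF _ S.one_closed]) (simp add: I(2))
  then show "\<zero> \<in> {a \<in> carrier R. \<exists>s\<in>S. s \<otimes> a \<in> I}" by simp
  fix a b assume "a \<in> {a \<in> carrier R. \<exists>s\<in>S. s \<otimes> a \<in> I}" "b \<in> {a \<in> carrier R. \<exists>s\<in>S. s \<otimes> a \<in> I}"
  then obtain s t where st: "a \<in> carrier R" "b \<in> carrier R" "s \<in> S" "s \<otimes> a \<in> I" "t \<in> S" "t \<otimes> b \<in> I"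
    by blast
  have "(s \<otimes> t) \<otimes> (a \<oplus> b) = t \<otimes> (s \<otimes> a) \<oplus> s \<otimes> (t \<otimes> b)"
    using st(1,2) st(3,5)[THEN S.mem_carrier] by algebra
  then have "(s \<otimes> t) \<otimes> (a \<oplus> b) \<in> I" using st I(3,4) S.mem_carrier by presburger
  then show "a \<oplus> b \<in> {a \<in> carrier R. \<exists>s\<in>S. s \<otimes> a \<in> I}" using st by blast
next
  interpret S: submonoid S R by fact
  note I = ideal_props[OF assms(2)]
  fix r a assume r: "r \<in> carrier R" "a \<in> {a \<in> carrier R. \<exists>s\<in>S. s \<otimes> a \<in> I}"
  then obtain s where s: "s \<in> S" "s \<otimes> a \<in> I" "a \<in> carrier R" by blast
  have "s \<otimes> (r \<otimes> a) = r \<otimes> (s \<otimes> a)" using r(1) s(3) S.mem_carrier[OF s(1)] by algebra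
  then have "s \<otimes> (r \<otimes> a) \<in> I" using I(4)[OF r(1) s(2)] by simp
  then show "r \<otimes> a \<in> {a \<in> carrier R. \<exists>s\<in>S. s \<otimes> a \<in> I}" using r s by auto
qed auto

lemma subset_saturation:
  assumes "submonoid S R" "ideal I R"
  shows "I \<subseteq> saturation R S I"
  unfolding saturation_def
  using submonoid.one_closed[OF assms(1)] ideal_props[OF assms(2)] by force

lemma saturated_saturation:
  assumes "submonoid S R" "ideal I R"
  shows "saturated R S (saturation R S I)"
  unfolding saturation_def saturated_def
proof safe
  interpret S: submonoid S R by fact
  fix a s t assume *: "a \<in> carrier R" "s \<in> S" "t \<in> S" "t \<otimes> (s \<otimes> a) \<in> I"
  then have "(t \<otimes> s) \<otimes> a \<in> I" by (simp add: m_assoc)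
  then show "\<exists>s\<in>S. s \<otimes> a \<in> I" using * by blast
qed

lemma saturation_mono: "I \<subseteq> J \<Longrightarrow> saturation R S I \<subseteq> saturation R S J"
  unfolding saturation_def by blast

lemma saturation_subset: "saturated R S I \<Longrightarrow> saturation R S I \<subseteq> I"
  unfolding saturation_def saturated_def by blast

lemma saturatedD: "saturated R S I \<Longrightarrow> a \<in> carrier R \<Longrightarrow> s \<in> S \<Longrightarrow> s \<otimes> a \<in> I \<Longrightarrow> a \<in> I"
  unfolding saturated_def by blast

text \<open>
  Every prime over an ideal contains one that is minimal over it: primes are closed under
  intersections of chains, so this is Zorn's lemma for reverse inclusion.
\<close>

lemma exists_prime_minimal_over:
  assumes "primeideal P R" "J \<subseteq> P"
  shows "\<exists>Q. primeideal Q R \<and> J \<subseteq> Q \<and> Q \<subseteq> P \<and>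
    (\<forall>P'. primeideal P' R \<longrightarrow> J \<subseteq> P' \<longrightarrow> P' \<subseteq> Q \<longrightarrow> P' = Q)"
proof -
  define A where "A = {Q. primeideal Q R \<and> J \<subseteq> Q \<and> Q \<subseteq> P}"
  define r where "r = (\<lambda>X Y. Y \<subseteq> (X::'a set))"
  have "\<exists>m\<in>A. \<forall>a\<in>A. r m a \<longrightarrow> a = m"
  proof (rule predicate_Zorn)
    show "partial_order_on A (relation_of r A)"
      unfolding partial_order_on_def preorder_on_def r_def relation_of_def refl_on_def trans_def antisym_def
      by auto
    fix C assume C: "C \<in> Chains (relation_of r A)"
    then have CA: "C \<subseteq> A" and ch: "\<And>X Y. X \<in> C \<Longrightarrow> Y \<in> C \<Longrightarrow> X \<subseteq> Y \<or> Y \<subseteq> X"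
      unfolding Chains_def relation_of_def r_def by auto
    show "\<exists>u\<in>A. \<forall>a\<in>C. r a u"
    proof (cases "C = {}")
      case True then show ?thesis using assms A_def by auto
    next
      case False
      have pr: "\<And>X. X \<in> C \<Longrightarrow> primeideal X R" using CA A_def by auto
      have id: "ideal (\<Inter>C) R" by (rule i_Intersect) (use pr prime_props(1) False in auto)
      have "primeideal (\<Inter>C) R"
      proof (rule prime_by_closure[OF id])
        show "\<one> \<notin> \<Inter>C" using False pr prime_props(2) by blast
        fix a b assume ab: "a \<in> carrier R" "b \<in> carrier R" "a \<otimes> b \<in> \<Inter>C"
        show "a \<in> \<Inter>C \<or> b \<in> \<Inter>C"
        proof (rule ccontr)
          assume "\<not> ?thesis"
          then obtain X Y where XY: "X \<in> C" "a \<notin> X" "Y \<in> C" "b \<notin> Y" by blast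
          then obtain Z where "Z \<in> C" "a \<notin> Z" "b \<notin> Z" using ch by blast
          then show False using prime_props(3)[OF pr ab(1,2)] ab(3) by blast
        qed
      qed
      moreover have "J \<subseteq> \<Inter>C" "\<Inter>C \<subseteq> P" using CA False unfolding A_def by auto
      ultimately show ?thesis unfolding A_def r_def by auto
    qed
  qed
  then obtain Q where Q: "Q \<in> A" "\<And>Q'. Q' \<in> A \<Longrightarrow> Q' \<subseteq> Q \<Longrightarrow> Q' = Q" unfolding r_def by blast
  have "P' = Q" if "primeideal P' R" "J \<subseteq> P'" "P' \<subseteq> Q" for P'
  proof -
    have "P' \<in> A" using Q(1) that unfolding A_def by auto
    then show ?thesis using Q(2) that(3) by blast
  qed
  then show ?thesis using Q(1) unfolding A_def by blast
qed

end

context noetherian_cring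
begin

lemma exists_maximal_ideal_in_family:
  assumes "F \<noteq> {}" "\<And>I. I \<in> F \<Longrightarrow> ideal I R"
  shows "\<exists>M\<in>F. \<forall>J\<in>F. M \<subseteq> J \<longrightarrow> J = M"
proof (rule subset_Zorn)
  fix C assume C: "subset.chain F C"
  show "\<exists>U\<in>F. \<forall>X\<in>C. X \<subseteq> U"
  proof (cases "C = {}")
    case True then show ?thesis using assms by auto
  next
    case False
    have "subset.chain {I. ideal I R} C" using C assms(2) unfolding pred_on.chain_def by auto
    then have "\<Union>C \<in> C" by (rule ideal_chain_is_trivial[OF False])
    then have "\<Union>C \<in> F" using C unfolding pred_on.chain_def by (meson subsetD)
    then show ?thesis by (rule bexI[rotated]) (simp add: Sup_upper)
  qed
qed

lemma ascending_ideals_stabilize: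
  assumes "\<And>n::nat. ideal (C n) R" "\<And>n. C n \<subseteq> C (Suc n)"
  shows "\<exists>n. \<forall>m\<ge>n. C m = C n"
proof -
  have "\<exists>M\<in>range C. \<forall>J\<in>range C. M \<subseteq> J \<longrightarrow> J = M"
    by (rule exists_maximal_ideal_in_family) (use assms(1) in auto)
  then obtain n where n: "\<forall>J\<in>range C. C n \<subseteq> J \<longrightarrow> J = C n" by (elim bexE rangeE) simp
  have "C n \<subseteq> C m" if "m \<ge> n" for m using lift_Suc_mono_le[of C] assms(2) that by blast
  then show ?thesis using n by (intro exI[of _ n]) simp
qed

lemma exists_prime_disjoint:
  assumes "ideal I R" "submonoid S R" "I \<inter> S = {}"
  obtains P where "primeideal P R" "I \<subseteq> P" "P \<inter> S = {}"
proof -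
  interpret S: submonoid S R by fact
  let ?F = "{J. ideal J R \<and> I \<subseteq> J \<and> J \<inter> S = {}}"
  have "\<exists>M\<in>?F. \<forall>J\<in>?F. M \<subseteq> J \<longrightarrow> J = M"
    by (rule exists_maximal_ideal_in_family) (use assms(1,3) in auto)
  then obtain M where M: "M \<in> ?F" "\<forall>J\<in>?F. M \<subseteq> J \<longrightarrow> J = M"
    by (rule bexE)
  then have idM: "ideal M R" and IM: "I \<subseteq> M" and MS: "M \<inter> S = {}" by auto
  have meet: "\<exists>m\<in>M. \<exists>r\<in>carrier R. m \<oplus> r \<otimes> a \<in> S" if a: "a \<in> carrier R" "a \<notin> M" for a
  proof (rule ccontr)
    assume "\<not> ?thesis"
    then have "adjoin M a \<inter> S = {}" by (auto simp: mem_adjoin_iff)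
    then have "adjoin M a = M"
      using M(2)[rule_format, of "adjoin M a"] ideal_adjoin[OF idM a(1)] subset_adjoin[OF idM a(1)] IM by auto
    then show False using mem_adjoin_self[OF idM a(1)] a(2) by simp
  qed
  have "primeideal M R"
  proof (rule prime_by_closure[OF idM])
    show "\<one> \<notin> M" using MS S.one_closed by blast
    fix a b assume ab: "a \<in> carrier R" "b \<in> carrier R" "a \<otimes> b \<in> M"
    show "a \<in> M \<or> b \<in> M"
    proof (rule ccontr)
      assume "\<not> ?thesis"
      then obtain m r n t where *: "m \<in> M" "r \<in> carrier R" "m \<oplus> r \<otimes> a \<in> S"
        "n \<in> M" "t \<in> carrier R" "n \<oplus> t \<otimes> b \<in> S"
        using meet ab by metis
      have c: "m \<in> carrier R" "n \<in> carrier R" using * ideal_props(6)[OF idM] by auto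
      have "(m \<oplus> r \<otimes> a) \<otimes> (n \<oplus> t \<otimes> b) =
        (n \<oplus> t \<otimes> b) \<otimes> m \<oplus> ((r \<otimes> a) \<otimes> n \<oplus> (r \<otimes> t) \<otimes> (a \<otimes> b))"
        using c * ab by algebra
      also have "\<dots> \<in> M"
        using ideal_props(4)[OF idM, of "n \<oplus> t \<otimes> b" m] ideal_props(4)[OF idM, of "r \<otimes> a" n]
          ideal_props(4)[OF idM, of "r \<otimes> t" "a \<otimes> b"] ideal_props(3)[OF idM] c * ab
        by simp
      finally show False using MS S.m_closed[OF *(3,6)] by blast
    qed
  qed
  then show ?thesis using that IM MS by blast
qed

lemma exists_prime_over:
  assumes "ideal I R" "\<one> \<notin> I"
  obtains P where "primeideal P R" "I \<subseteq> P"
proof -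
  have "submonoid {\<one>} R" by unfold_locales auto
  moreover have "I \<inter> {\<one>} = {}" using assms(2) by simp
  ultimately show ?thesis using exists_prime_disjoint[OF assms(1)] that by metis
qed

end

section \<open>Nonzerodivisors in reduced Noetherian rings\<close>

definition reduced_ring :: "('a, 'b) ring_scheme \<Rightarrow> bool" where
  "reduced_ring R \<longleftrightarrow> (\<forall>x\<in>carrier R. \<forall>n::nat. x [^]\<^bsub>R\<^esub> n = \<zero>\<^bsub>R\<^esub> \<longrightarrow> x = \<zero>\<^bsub>R\<^esub>)"

definition nonzerodivisors :: "('a, 'b) ring_scheme \<Rightarrow> 'a set" where
  "nonzerodivisors R = {c \<in> carrier R. \<forall>y\<in>carrier R. c \<otimes>\<^bsub>R\<^esub> y = \<zero>\<^bsub>R\<^esub> \<longrightarrow> y = \<zero>\<^bsub>R\<^esub>}"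

lemma (in cring) reduced_square:
  assumes "reduced_ring R" "y \<in> carrier R" "y \<otimes> y = \<zero>"
  shows "y = \<zero>"
proof -
  have "y [^] (2::nat) = \<zero>" using assms by (simp add: numeral_2_eq_2)
  then show ?thesis using assms unfolding reduced_ring_def by blast
qed

text \<open>
  A reduced ring has for each \<open>y \<noteq> 0\<close> a minimal prime without \<open>y\<close>, so a \<open>c\<close> that kills \<open>y\<close> lies
  in it. Conversely, if \<open>c\<close> lies in a minimal prime \<open>P\<close>, no prime avoids all the products
  \<open>t c\<^sup>n\<close> with \<open>t \<notin> P\<close>; hence one of these vanishes although \<open>t \<noteq> 0\<close>, and \<open>c\<close> is a zero divisor.
\<close>

lemma (in noetherian_cring) ring_circ_reduced:
  assumes red: "reduced_ring R"
  shows "ring_circ R = nonzerodivisors R"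
proof safe
  fix c assume c: "c \<in> ring_circ R"
  then have cc: "c \<in> carrier R" unfolding ring_circ_def by auto
  have "y = \<zero>" if y: "y \<in> carrier R" "c \<otimes> y = \<zero>" for y
  proof (rule ccontr)
    assume "y \<noteq> \<zero>"
    then have "y [^] n \<noteq> \<zero>" for n :: nat using red y(1) unfolding reduced_ring_def by blast
    then have "{\<zero>} \<inter> {y [^] (n::nat) | n. True} = {}" by fastforce
    then obtain P where P: "primeideal P R" "P \<inter> {y [^] (n::nat) | n. True} = {}"
      by (rule exists_prime_disjoint[OF zeroideal submonoid_powers[OF y(1)]])
    obtain Q where Q: "primeideal Q R" "Q \<subseteq> P"
      "\<And>P'. primeideal P' R \<Longrightarrow> {\<zero>} \<subseteq> P' \<Longrightarrow> P' \<subseteq> Q \<Longrightarrow> P' = Q"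
      using exists_prime_minimal_over[OF P(1), of "{\<zero>}"] ideal_props(2)[OF prime_props(1)[OF P(1)]] by auto
    have "minimal_prime Q R"
      unfolding minimal_prime_def using Q ideal_props(2)[OF prime_props(1)] by blast
    then have "c \<notin> Q" using c unfolding ring_circ_def by auto
    moreover have "y \<in> {y [^] (n::nat) | n. True}" by (intro CollectI exI[of _ 1]) (simp add: y(1))
    then have "y \<notin> Q" using P(2) Q(2) by blast
    ultimately show False
      using prime_props(3)[OF Q(1) cc y(1)] y(2) ideal_props(2)[OF prime_props(1)[OF Q(1)]] by auto
  qed
  then show "c \<in> nonzerodivisors R" using cc unfolding nonzerodivisors_def by auto
next
  fix c assume c: "c \<in> nonzerodivisors R"
  then have cc: "c \<in> carrier R" unfolding nonzerodivisors_def by auto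
  have "c \<notin> P" if "minimal_prime P R" for P
  proof
    assume cP: "c \<in> P"
    have P: "primeideal P R" and min: "\<And>Q. primeideal Q R \<Longrightarrow> Q \<subseteq> P \<Longrightarrow> Q = P"
      using that unfolding minimal_prime_def by auto
    let ?S = "carrier R - P"
    define T where "T = {t \<otimes> c [^] (n::nat) | t n. t \<in> ?S}"
    have T: "submonoid T R"
      unfolding T_def by (rule submonoid_times_powers[OF submonoid_prime_complement[OF P] cc])
    have ST: "t \<in> T" if "t \<in> ?S" for t
    proof -
      have "t = t \<otimes> c [^] (0::nat)" using that by simp
      then show ?thesis unfolding T_def using that by (intro CollectI exI[of _ t] exI[of _ 0]) simp
    qed
    have "\<one> \<in> ?S" using prime_props(2)[OF P] by simp
    then have cT: "c \<in> T" unfolding T_def by (intro CollectI exI[of _ \<one>] exI[of _ 1]) (simp add: cc)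
    have "\<zero> \<in> T"
    proof (rule ccontr)
      assume "\<zero> \<notin> T"
      then have "{\<zero>} \<inter> T = {}" by blast
      then obtain Q where Q: "primeideal Q R" "Q \<inter> T = {}"
        by (rule exists_prime_disjoint[OF zeroideal T])
      have "Q \<subseteq> carrier R" using ideal_props(1)[OF prime_props(1)[OF Q(1)]] .
      have "Q \<subseteq> P"
      proof
        fix a assume a: "a \<in> Q"
        then have "a \<notin> T" using Q(2) by (meson disjoint_iff)
        then show "a \<in> P" using ST[of a] a \<open>Q \<subseteq> carrier R\<close> by (meson DiffI subsetD)
      qed
      then have "Q = P" by (rule min[OF Q(1)])
      then have "c \<in> Q \<inter> T" using cP cT by simp
      then show False using Q(2) by simp
    qed
    then obtain t n where t: "t \<in> carrier R" "t \<notin> P" "t \<otimes> c [^] (n::nat) = \<zero>"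
      unfolding T_def by auto
    have "t = \<zero>" using t(3)
    proof (induction n)
      case 0 then show ?case using t(1) by simp
    next
      case (Suc n)
      have "c \<otimes> (t \<otimes> c [^] n) = t \<otimes> (c [^] n \<otimes> c)"
        using t(1) cc nat_pow_closed[OF cc, of n] by algebra
      then have "t \<otimes> c [^] n = \<zero>" using Suc.prems c t(1) cc unfolding nonzerodivisors_def by auto
      then show ?case by (rule Suc.IH)
    qed
    then show False using t ideal_props(2)[OF prime_props(1)[OF P]] by simp
  qed
  then show "c \<in> ring_circ R" using cc unfolding ring_circ_def by auto
qed

text \<open>
  In a reduced ring \<open>c d = 0\<close> gives \<open>Ann (c + d) = Ann c \<inter> Ann d\<close>. If \<open>y \<noteq> 0\<close> lies in it, then
  \<open>d + y\<close> still kills \<open>c\<close>, and \<open>y\<close> itself no longer kills \<open>c + d + y\<close> because \<open>y\<^sup>2 \<noteq> 0\<close>; so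
  \<open>Ann (c + d)\<close> shrinks strictly until it is zero. Annihilators satisfy the descending chain
  condition because their own annihilators ascend.
\<close>

lemma (in noetherian_cring) exists_complementary_summand:
  assumes red: "reduced_ring R" and c: "c \<in> carrier R"
  obtains d where "d \<in> carrier R" "c \<otimes> d = \<zero>" "c \<oplus> d \<in> nonzerodivisors R"
proof -
  \<comment> \<open>The annihilator of the annihilator of \<open>x\<close>.\<close>
  let ?dann = "\<lambda>x. {b \<in> carrier R. \<forall>y\<in>carrier R. x \<otimes> y = \<zero> \<longrightarrow> b \<otimes> y = \<zero>}"
  let ?D = "{d \<in> carrier R. c \<otimes> d = \<zero>}"
  have id: "ideal (?dann x) R" for x
  proof (rule ideal_by_closure)
    fix a b assume "a \<in> ?dann x" "b \<in> ?dann x"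
    then show "a \<oplus> b \<in> ?dann x" by (auto simp: l_distr)
  next
    fix r a assume "r \<in> carrier R" "a \<in> ?dann x"
    then show "r \<otimes> a \<in> ?dann x" by (auto simp: m_assoc)
  qed auto
  let ?F = "(\<lambda>d. ?dann (c \<oplus> d)) ` ?D"
  have "\<exists>M\<in>?F. \<forall>J\<in>?F. M \<subseteq> J \<longrightarrow> J = M"
  proof (rule exists_maximal_ideal_in_family)
    have "\<zero> \<in> ?D" using c by simp
    then show "?F \<noteq> {}" by blast
    show "ideal I R" if "I \<in> ?F" for I using that id by blast
  qed
  then obtain M where M: "M \<in> ?F" "\<forall>J\<in>?F. M \<subseteq> J \<longrightarrow> J = M" by (rule bexE)
  then obtain d where d: "d \<in> carrier R" "c \<otimes> d = \<zero>" "M = ?dann (c \<oplus> d)" by blast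
  have split: "c \<otimes> y = \<zero> \<and> e \<otimes> y = \<zero>"
    if "e \<in> carrier R" "c \<otimes> e = \<zero>" "y \<in> carrier R" "(c \<oplus> e) \<otimes> y = \<zero>" for e y
  proof -
    have "(e \<otimes> y) \<otimes> (e \<otimes> y) = (e \<otimes> y) \<otimes> ((c \<oplus> e) \<otimes> y) \<ominus> (c \<otimes> e) \<otimes> (y \<otimes> y)"
      using that(1,3) c by algebra
    also have "\<dots> = \<zero>" unfolding that(2,4) using that(1,3) by (simp add: a_minus_def)
    finally have ey: "e \<otimes> y = \<zero>" by (rule reduced_square[OF red, rotated]) (use that in simp)
    have "c \<otimes> y = (c \<oplus> e) \<otimes> y \<ominus> e \<otimes> y" using that(1,3) c by algebra
    then show ?thesis using ey that by (simp add: a_minus_def)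
  qed
  have "y = \<zero>" if y: "y \<in> carrier R" "(c \<oplus> d) \<otimes> y = \<zero>" for y
  proof -
    have cy: "c \<otimes> y = \<zero>" and dy: "d \<otimes> y = \<zero>" using split[OF d(1,2) y] by auto
    have e: "d \<oplus> y \<in> carrier R" "c \<otimes> (d \<oplus> y) = \<zero>"
      using cy d y c by (simp_all add: r_distr)
    have "?dann (c \<oplus> d) \<subseteq> ?dann (c \<oplus> (d \<oplus> y))"
    proof safe
      fix b w assume b: "b \<in> carrier R" "\<forall>w\<in>carrier R. (c \<oplus> d) \<otimes> w = \<zero> \<longrightarrow> b \<otimes> w = \<zero>"
        and w: "w \<in> carrier R" "(c \<oplus> (d \<oplus> y)) \<otimes> w = \<zero>"
      have cw: "c \<otimes> w = \<zero>" and ew: "(d \<oplus> y) \<otimes> w = \<zero>" using split[OF e w] by auto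
      \<comment> \<open>The same square trick separates \<open>d\<close> from \<open>y\<close>, since \<open>d y = 0\<close>.\<close>
      have "(d \<otimes> w) \<otimes> (d \<otimes> w) = (d \<otimes> w) \<otimes> ((d \<oplus> y) \<otimes> w) \<ominus> (d \<otimes> y) \<otimes> (w \<otimes> w)"
        using d(1) y(1) w(1) by algebra
      also have "\<dots> = \<zero>" unfolding ew dy using d w by (simp add: a_minus_def)
      finally have "d \<otimes> w = \<zero>" by (rule reduced_square[OF red, rotated]) (use d w in simp)
      then have "(c \<oplus> d) \<otimes> w = \<zero>" using cw c d w by (simp add: l_distr)
      then show "b \<otimes> w = \<zero>" using b w by blast
    qed
    then have eq: "?dann (c \<oplus> (d \<oplus> y)) = ?dann (c \<oplus> d)"
      using bspec[OF M(2), of "?dann (c \<oplus> (d \<oplus> y))"] e d(3) by (simp add: image_iff) metis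
    have "c \<oplus> (d \<oplus> y) \<in> ?dann (c \<oplus> (d \<oplus> y))" using c e by auto
    then have "(c \<oplus> (d \<oplus> y)) \<otimes> y = \<zero>" unfolding eq using y by blast
    moreover have "(c \<oplus> (d \<oplus> y)) \<otimes> y = c \<otimes> y \<oplus> (d \<otimes> y \<oplus> y \<otimes> y)"
      using c d(1) y(1) by algebra
    ultimately have "y \<otimes> y = \<zero>" using cy dy y by simp
    then show "y = \<zero>" by (rule reduced_square[OF red y(1)])
  qed
  then have "c \<oplus> d \<in> nonzerodivisors R" using c d unfolding nonzerodivisors_def by auto
  then show ?thesis using that d by blast
qed

section \<open>Krull's principal ideal theorem\<close>

context noetherian_cring
begin

text \<open>
  If \<open>Q\<close> is minimal over \<open>J\<close>, then \<open>R\<^sub>Q / J R\<^sub>Q\<close> is Artinian; ideals of \<open>R\<^sub>Q\<close> appear here as ideals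
  saturated at the complement of \<open>Q\<close>. The proof is Noetherian induction on \<open>J\<close>. A maximal
  proper colon ideal \<open>M : y\<close> is prime and hence equals \<open>Q\<close>, so that \<open>M + (y)\<close> covers \<open>M\<close>. A chain
  above \<open>M\<close> either stays above \<open>M + (y)\<close> or eventually meets it in \<open>M\<close> only, and in both cases a
  chain above \<open>M + (y)\<close> decides whether it becomes stationary.
\<close>

lemma descending_saturated_ideals_stabilize:
  assumes Q: "primeideal Q R"
    and min: "\<And>P'. primeideal P' R \<Longrightarrow> J \<subseteq> P' \<Longrightarrow> P' \<subseteq> Q \<Longrightarrow> P' = Q"
    and J: "ideal J R" "saturated R (carrier R - Q) J"
    and C: "\<And>n::nat. ideal (C n) R" "\<And>n. saturated R (carrier R - Q) (C n)"
      "\<And>n. J \<subseteq> C n" "\<And>n. C (Suc n) \<subseteq> C n"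
  shows "\<exists>n. C n = C (Suc n)"
proof (rule ccontr)
  assume nostab: "\<nexists>n. C n = C (Suc n)"
  let ?W = "carrier R - Q"
  have W: "submonoid ?W R" by (rule submonoid_prime_complement[OF Q])
  define bad where "bad M \<longleftrightarrow> (\<exists>C. (\<forall>n::nat. ideal (C n) R \<and> saturated R ?W (C n) \<and> M \<subseteq> C n \<and>
    C (Suc n) \<subseteq> C n \<and> C n \<noteq> C (Suc n)))" for M
  define F where "F = {M. ideal M R \<and> saturated R ?W M \<and> J \<subseteq> M \<and> bad M}"
  have "bad J" unfolding bad_def by (rule exI[of _ C]) (use C nostab in auto)
  then have "J \<in> F" using J unfolding F_def by auto
  have "\<exists>M\<in>F. \<forall>J\<in>F. M \<subseteq> J \<longrightarrow> J = M"
    by (rule exists_maximal_ideal_in_family) (use \<open>J \<in> F\<close> in \<open>auto simp: F_def\<close>)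
  then obtain M where MF: "M \<in> F" and Mmax: "\<forall>J\<in>F. M \<subseteq> J \<longrightarrow> J = M" by (rule bexE)
  then have M: "ideal M R" "saturated R ?W M" "J \<subseteq> M" "bad M" unfolding F_def by auto
  obtain D where D: "\<And>n::nat. ideal (D n) R" "\<And>n. saturated R ?W (D n)" "\<And>n. M \<subseteq> D n"
    "\<And>n. D (Suc n) \<subseteq> D n" "\<And>n. D n \<noteq> D (Suc n)"
    using M(4) unfolding bad_def by metis
  define G where "G = colon R M ` (carrier R - M)"
  obtain y0 where y0: "y0 \<in> D 0" "y0 \<notin> D (Suc 0)" using D(4,5)[of 0] by blast
  then have "y0 \<in> carrier R - M" using D(3)[of "Suc 0"] ideal_props(6)[OF D(1)[of 0]] by blast
  then have "G \<noteq> {}" unfolding G_def by blast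
  then have "\<exists>M\<in>G. \<forall>J\<in>G. M \<subseteq> J \<longrightarrow> J = M"
    by (rule exists_maximal_ideal_in_family) (use ideal_colon[OF M(1)] in \<open>auto simp: G_def\<close>)
  then obtain y where y: "y \<in> carrier R" "y \<notin> M" "\<forall>J\<in>G. colon R M y \<subseteq> J \<longrightarrow> J = colon R M y"
    unfolding G_def by auto
  have MK: "M \<subseteq> colon R M y"
    unfolding colon_def using ideal_props[OF M(1)] y(1) m_comm by fastforce
  have "primeideal (colon R M y) R"
  proof (rule prime_by_closure[OF ideal_colon[OF M(1) y(1)]])
    show "\<one> \<notin> colon R M y" using y unfolding colon_def by simp
    fix a b assume ab: "a \<in> carrier R" "b \<in> carrier R" "a \<otimes> b \<in> colon R M y"
    show "a \<in> colon R M y \<or> b \<in> colon R M y"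
    proof (cases "b \<otimes> y \<in> M")
      case True then show ?thesis using ab unfolding colon_def by simp
    next
      case False
      have "colon R M y \<subseteq> colon R M (b \<otimes> y)"
      proof
        fix r assume r: "r \<in> colon R M y"
        then have rc: "r \<in> carrier R" "r \<otimes> y \<in> M" unfolding colon_def by auto
        have "r \<otimes> (b \<otimes> y) = b \<otimes> (r \<otimes> y)" using rc(1) ab(2) y(1) by algebra
        then show "r \<in> colon R M (b \<otimes> y)"
          using ideal_props(4)[OF M(1) ab(2) rc(2)] rc(1) unfolding colon_def by simp
      qed
      moreover have "colon R M (b \<otimes> y) \<in> G" unfolding G_def using False ab y by simp
      ultimately have "colon R M (b \<otimes> y) = colon R M y" using y(3) by simp
      moreover have "a \<in> colon R M (b \<otimes> y)" using ab y(1) unfolding colon_def by (simp add: m_assoc)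
      ultimately show ?thesis by simp
    qed
  qed
  moreover have "colon R M y \<subseteq> Q"
  proof
    fix r assume r: "r \<in> colon R M y"
    show "r \<in> Q"
    proof (rule ccontr)
      assume "r \<notin> Q"
      then have "y \<in> M" using saturatedD[OF M(2) y(1), of r] r unfolding colon_def by simp
      then show False using y(2) by simp
    qed
  qed
  ultimately have KQ: "colon R M y = Q" using min M(3) MK by (meson subset_trans)
  define M' where "M' = saturation R ?W (adjoin M y)"
  note adM = ideal_adjoin[OF M(1) y(1)]
  have M': "ideal M' R" "saturated R ?W M'" "M \<subseteq> M'" "y \<in> M'"
    unfolding M'_def
    using ideal_saturation[OF W adM] saturated_saturation[OF W adM] subset_saturation[OF W adM]
      subset_adjoin[OF M(1) y(1)] mem_adjoin_self[OF M(1) y(1)] by auto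
  have notbad: "\<not> bad M'"
  proof
    assume "bad M'"
    then have "M' \<in> F" using M' M(3) unfolding F_def by auto
    then have "M' = M" using Mmax M'(3) by simp
    then show False using M'(4) y(2) by simp
  qed
  show False
  proof (cases "\<forall>n. y \<in> D n")
    case True
    have "M' \<subseteq> D n" for n
    proof -
      have "adjoin M y \<subseteq> D n" using adjoin_subset[OF D(1) D(3)] True by simp
      then show ?thesis
        unfolding M'_def using saturation_mono saturation_subset[OF D(2)[of n]] by (meson subset_trans)
    qed
    then have "bad M'" unfolding bad_def using D by (intro exI[of _ D]) simp
    then show False using notbad by simp
  next
    case False
    then obtain N where N: "y \<notin> D N" by blast
    define E where "E k = saturation R ?W (adjoin (D (N + k)) y)" for k
    note adD = ideal_adjoin[OF D(1) y(1)]
    have E: "ideal (E k) R" "saturated R ?W (E k)" for k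
      unfolding E_def using ideal_saturation[OF W adD] saturated_saturation[OF W adD] by auto
    have adj_mono: "adjoin A y \<subseteq> adjoin B y" if "ideal B R" "A \<subseteq> B" for A B
      using adjoin_subset[OF ideal_adjoin[OF that(1) y(1)], of A y] subset_adjoin[OF that(1) y(1)]
        mem_adjoin_self[OF that(1) y(1)] that(2) by (meson subset_trans)
    have ME: "M' \<subseteq> E k" for k
      unfolding M'_def E_def by (intro saturation_mono adj_mono D)
    have decE: "E (Suc k) \<subseteq> E k" for k
      unfolding E_def by (intro saturation_mono adj_mono D) (use D(4) in simp)
    obtain k where k: "E k = E (Suc k)"
      using notbad E ME decE unfolding bad_def by metis
    have "D (N + k) \<subseteq> D (Suc (N + k))"
    proof
      fix a assume a: "a \<in> D (N + k)"
      have ac: "a \<in> carrier R" using ideal_props(6)[OF D(1) a] .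
      have "a \<in> E k"
        unfolding E_def using subset_saturation[OF W adD] subset_adjoin[OF D(1) y(1)] a by blast
      then have "a \<in> saturation R ?W (adjoin (D (Suc (N + k))) y)" unfolding k by (simp add: E_def)
      then obtain t b r where t: "t \<in> ?W" "b \<in> D (Suc (N + k))" "r \<in> carrier R" "t \<otimes> a = b \<oplus> r \<otimes> y"
        unfolding saturation_def mem_adjoin_iff by auto
      have bD: "b \<in> D (N + k)" using t(2) D(4) by auto
      have ta: "t \<otimes> a \<in> D (N + k)" using ideal_props(4)[OF D(1) _ a] t(1) by simp
      have ry: "r \<otimes> y \<in> D (N + k)"
        by (rule ideal_cancel_left[OF D(1) _ bD]) (use ta t y in auto)
      have "D (N + k) \<subseteq> D N" using lift_Suc_antimono_le[of D N "N + k"] D(4) by simp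
      then have "r \<otimes> y \<in> D N" using ry by blast
      then have "r \<notin> ?W" using saturatedD[OF D(2) y(1)] N by blast
      then have "r \<in> colon R M y" using KQ t(3) by simp
      then have "r \<otimes> y \<in> D (Suc (N + k))" using D(3) unfolding colon_def by auto
      then have "t \<otimes> a \<in> D (Suc (N + k))" using ideal_props(3)[OF D(1) t(2)] t(4) by simp
      then show "a \<in> D (Suc (N + k))" by (rule saturatedD[OF D(2) ac t(1)])
    qed
    then show False using D(4,5)[of "N + k"] by blast
  qed
qed

text \<open>
  This is the principal ideal theorem for \<open>R / P\<close>: when \<open>Q\<close> is minimal over \<open>P + (x)\<close>, the element
  \<open>x\<close> of the domain \<open>R\<^sub>Q / P R\<^sub>Q\<close> lies in the radical of every nonzero principal ideal \<open>(y)\<close>, so there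
  is no prime strictly between \<open>P\<close> and \<open>Q\<close>. The ideals \<open>I\<^sub>n = (P + (y\<^sup>n)) : x\<^sup>\<infinity>\<close> descend, and
  their sums with \<open>(x)\<close> become stationary. As \<open>x\<close> can be cancelled in \<open>I\<^sub>n\<close>, that
  means \<open>I\<^sub>n = I\<^sub>n\<^sub>+\<^sub>1 + x I\<^sub>n\<close>, whence \<open>I\<^sub>n = I\<^sub>n\<^sub>+\<^sub>1\<close> by Nakayama. Now \<open>y\<^sup>n \<in> I\<^sub>n\<^sub>+\<^sub>1\<close>
  gives \<open>x\<^sup>k y\<^sup>n = r y\<^sup>n\<^sup>+\<^sup>1\<close> modulo \<open>P\<close>, and \<open>y\<^sup>n\<close> cancels.
\<close>

lemma principal_ideal_theorem:
  assumes P: "primeideal P R" and Q: "primeideal Q R" and x: "x \<in> Q"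
    and min: "\<And>P'. primeideal P' R \<Longrightarrow> P \<subseteq> P' \<Longrightarrow> x \<in> P' \<Longrightarrow> P' \<subseteq> Q \<Longrightarrow> P' = Q"
    and y: "y \<in> carrier R" "y \<notin> P"
  shows "\<exists>t\<in>carrier R - Q. \<exists>n::nat. t \<otimes> x [^] n \<in> adjoin P y"
proof -
  let ?W = "carrier R - Q"
  have W: "submonoid ?W R" by (rule submonoid_prime_complement[OF Q])
  note idP = prime_props(1)[OF P] and idQ = prime_props(1)[OF Q]
  have xc: "x \<in> carrier R" using ideal_props(6)[OF idQ x] .
  define T where "T = {t \<otimes> x [^] (n::nat) | t n. t \<in> ?W}"
  have T: "submonoid T R" unfolding T_def by (rule submonoid_times_powers[OF W xc])
  have WT: "?W \<subseteq> T"
  proof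
    fix t assume "t \<in> ?W"
    then show "t \<in> T" unfolding T_def by (intro CollectI exI[of _ t] exI[of _ 0]) auto
  qed
  have "\<one> \<in> ?W" using prime_props(2)[OF Q] by simp
  then have xT: "x \<in> T" unfolding T_def by (intro CollectI exI[of _ \<one>] exI[of _ 1]) (simp add: xc)
  have satW: "saturated R ?W A" if "saturated R T A" for A
    using that WT unfolding saturated_def by blast
  define I where "I n = saturation R T (adjoin P (y [^] n))" for n :: nat
  note yn = nat_pow_closed[OF y(1)]
  note adI = ideal_adjoin[OF idP yn]
  have I: "ideal (I n) R" "saturated R T (I n)" "P \<subseteq> I n" "y [^] n \<in> I n" for n
    unfolding I_def using ideal_saturation[OF T adI[of n]] saturated_saturation[OF T adI[of n]]
      subset_saturation[OF T adI[of n]] subset_adjoin[OF idP yn[of n]] mem_adjoin_self[OF idP yn[of n]]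
    by auto
  have decI: "I (Suc n) \<subseteq> I n" for n
  proof -
    have "adjoin P (y [^] Suc n) \<subseteq> adjoin P (y [^] n)"
    proof (rule adjoin_subset[OF adI subset_adjoin[OF idP yn]])
      show "y [^] Suc n \<in> adjoin P (y [^] n)"
        using ideal_props(4)[OF adI y(1) mem_adjoin_self[OF idP yn]] m_comm[OF y(1) yn] by simp
    qed
    then show ?thesis unfolding I_def by (rule saturation_mono)
  qed
  define J where "J n = saturation R ?W (adjoin (I n) x)" for n
  define J0 where "J0 = saturation R ?W (adjoin P x)"
  note adP = ideal_adjoin[OF idP xc] and adJ = ideal_adjoin[OF I(1) xc]
  have adj_mono: "adjoin A x \<subseteq> adjoin B x" if "ideal B R" "A \<subseteq> B" for A B
    using adjoin_subset[OF ideal_adjoin[OF that(1) xc], of A x] subset_adjoin[OF that(1) xc]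
      mem_adjoin_self[OF that(1) xc] that(2) by (meson subset_trans)
  have "\<exists>n. J n = J (Suc n)"
  proof (rule descending_saturated_ideals_stabilize[OF Q])
    show "ideal J0 R" "saturated R ?W J0"
      unfolding J0_def using ideal_saturation[OF W adP] saturated_saturation[OF W adP] by auto
    show "ideal (J n) R" "saturated R ?W (J n)" for n
      unfolding J_def using ideal_saturation[OF W adJ] saturated_saturation[OF W adJ] by auto
    show "J0 \<subseteq> J n" for n unfolding J_def J0_def by (intro saturation_mono adj_mono I)
    show "J (Suc n) \<subseteq> J n" for n unfolding J_def by (intro saturation_mono adj_mono I decI)
    fix P' assume P': "primeideal P' R" "J0 \<subseteq> P'" "P' \<subseteq> Q"
    have "P \<subseteq> J0" "x \<in> J0"
      unfolding J0_def using subset_saturation[OF W adP] subset_adjoin[OF idP xc]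
        mem_adjoin_self[OF idP xc] by auto
    then show "P' = Q" using min[OF P'(1)] P'(2,3) by blast
  qed
  then obtain n where n: "J n = J (Suc n)" by blast
  have "I n \<subseteq> I (Suc n)"
  proof (rule ccontr)
    assume notsub: "\<not> I n \<subseteq> I (Suc n)"
    \<comment> \<open>Nakayama, with a maximal proper subideal in place of a finite set of generators.\<close>
    define F where "F = {L. ideal L R \<and> saturated R ?W L \<and> I (Suc n) \<subseteq> L \<and> L \<subseteq> I n \<and> L \<noteq> I n}"
    have IF: "I (Suc n) \<in> F" unfolding F_def using I satW decI notsub by blast
    have "\<exists>L\<in>F. \<forall>L'\<in>F. L \<subseteq> L' \<longrightarrow> L' = L"
      by (rule exists_maximal_ideal_in_family) (use IF in \<open>auto simp: F_def\<close>)
    then obtain L where LF: "L \<in> F" and Lmax: "\<forall>L'\<in>F. L \<subseteq> L' \<longrightarrow> L' = L" by (rule bexE)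
    then have L: "ideal L R" "saturated R ?W L" "I (Suc n) \<subseteq> L" "L \<subseteq> I n" "L \<noteq> I n"
      unfolding F_def by auto
    obtain a where a: "a \<in> I n" "a \<notin> L" using L by blast
    have ac: "a \<in> carrier R" using ideal_props(6)[OF I(1) a(1)] .
    define L' where "L' = saturation R ?W (adjoin L a)"
    note adL = ideal_adjoin[OF L(1) ac]
    have L': "ideal L' R" "saturated R ?W L'" "L \<subseteq> L'" "a \<in> L'"
      unfolding L'_def
      using ideal_saturation[OF W adL] saturated_saturation[OF W adL] subset_saturation[OF W adL]
        subset_adjoin[OF L(1) ac] mem_adjoin_self[OF L(1) ac] by auto
    have "L' \<subseteq> I n"
      unfolding L'_def using adjoin_subset[OF I(1) L(4) a(1)] saturation_mono
        saturation_subset[OF satW[OF I(2)[of n]]] by (meson subset_trans)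
    moreover have "L' \<notin> F" using Lmax L'(3,4) a(2) by auto
    ultimately have L'I: "L' = I n" using L' L(3) unfolding F_def by auto
    have "a \<in> J n"
      unfolding J_def using subset_saturation[OF W adJ] subset_adjoin[OF I(1) xc] a(1) by blast
    then have "a \<in> saturation R ?W (adjoin (I (Suc n)) x)" unfolding n by (simp add: J_def)
    then obtain t b r where t: "t \<in> ?W" "b \<in> I (Suc n)" "r \<in> carrier R" "t \<otimes> a = b \<oplus> r \<otimes> x"
      unfolding saturation_def mem_adjoin_iff by auto
    have bI: "b \<in> I n" and bc: "b \<in> carrier R" using t(2) decI ideal_props(6)[OF I(1)] by auto
    have ta: "t \<otimes> a \<in> I n" using ideal_props(4)[OF I(1) _ a(1)] t(1) by simp
    have "r \<otimes> x \<in> I n"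
      by (rule ideal_cancel_left[OF I(1) _ bI]) (use ta t xc in auto)
    then have "x \<otimes> r \<in> I n" using t(3) xc by (simp add: m_comm)
    then have "r \<in> L'" unfolding L'I by (rule saturatedD[OF I(2) t(3) xT])
    then obtain u l v where u: "u \<in> ?W" "l \<in> L" "v \<in> carrier R" "u \<otimes> r = l \<oplus> v \<otimes> a"
      unfolding L'_def saturation_def mem_adjoin_iff by auto
    have lc: "l \<in> carrier R" using ideal_props(6)[OF L(1) u(2)] .
    have tu: "t \<in> carrier R" "u \<in> carrier R" using t(1) u(1) by auto
    have "(u \<otimes> t \<ominus> x \<otimes> v) \<otimes> a = u \<otimes> (t \<otimes> a) \<ominus> x \<otimes> (v \<otimes> a)"
      using tu xc u(3) ac by algebra
    also have "\<dots> = u \<otimes> b \<oplus> x \<otimes> (u \<otimes> r) \<ominus> x \<otimes> (v \<otimes> a)"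
      unfolding t(4) using tu xc u(3) ac bc t(3) by algebra
    also have "\<dots> = u \<otimes> b \<oplus> x \<otimes> l"
      unfolding u(4) using tu xc u(3) ac bc lc by algebra
    also have "\<dots> \<in> L"
      using ideal_props(4)[OF L(1) tu(2), of b] ideal_props(4)[OF L(1) xc u(2)] ideal_props(3)[OF L(1)]
        t(2) L(3) by auto
    finally have "(u \<otimes> t \<ominus> x \<otimes> v) \<otimes> a \<in> L" .
    moreover have "u \<otimes> t \<ominus> x \<otimes> v \<in> ?W"
    proof -
      have xv: "x \<otimes> v \<in> Q" using ideal_props(4)[OF idQ u(3) x] m_comm[OF xc u(3)] by simp
      have "u \<otimes> t \<notin> Q" using prime_props(3)[OF Q tu(2,1)] t(1) u(1) by blast
      moreover have "u \<otimes> t = (u \<otimes> t \<ominus> x \<otimes> v) \<oplus> x \<otimes> v" using tu xc u(3) by algebra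
      ultimately have "u \<otimes> t \<ominus> x \<otimes> v \<notin> Q" using ideal_props(3)[OF idQ _ xv] by metis
      then show ?thesis using tu xc u(3) by simp
    qed
    ultimately have "a \<in> L" by (rule saturatedD[OF L(2) ac, rotated])
    then show False using a(2) by simp
  qed
  then have "y [^] n \<in> I (Suc n)" using I(4) by blast
  then obtain s i r where s: "s \<in> T" "i \<in> P" "r \<in> carrier R" "s \<otimes> y [^] n = i \<oplus> r \<otimes> y [^] Suc n"
    unfolding I_def saturation_def mem_adjoin_iff by auto
  have sc: "s \<in> carrier R" using submonoid.mem_carrier[OF T s(1)] .
  have ic: "i \<in> carrier R" using ideal_props(6)[OF idP s(2)] .
  have "y [^] n \<otimes> (s \<ominus> r \<otimes> y) = s \<otimes> y [^] n \<ominus> r \<otimes> (y [^] n \<otimes> y)"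
    using sc s(3) yn[of n] y(1) by algebra
  also have "\<dots> = i" unfolding s(4) using ic s(3) yn[of n] y(1) by (simp, algebra)
  finally have "y [^] n \<otimes> (s \<ominus> r \<otimes> y) \<in> P" using s(2) by simp
  then have "y [^] n \<in> P \<or> s \<ominus> r \<otimes> y \<in> P"
    by (rule prime_props(3)[OF P yn, rotated]) (use sc s(3) y(1) in simp)
  moreover have "y [^] n \<notin> P" using prime_power[OF P y(1)] y(2) by metis
  ultimately have "s \<ominus> r \<otimes> y \<in> P" by simp
  moreover have "s = (s \<ominus> r \<otimes> y) \<oplus> r \<otimes> y" using sc s(3) y(1) by algebra
  ultimately have "s \<in> adjoin P y" unfolding mem_adjoin_iff using s(3) by metis
  then show ?thesis using s(1) unfolding T_def by auto
qed

end

section \<open>Weak F-regularity of a localization, tested in the ring itself\<close>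

text \<open>
  What weak F-regularity of \<open>S\<inverse>R\<close> says about a reduced Noetherian ring \<open>R\<close>: \<open>I\<close> and \<open>z\<close> stand for
  their images in \<open>S\<inverse>R\<close>, membership in an extended ideal is membership up to a factor in \<open>S\<close>, and
  the multipliers can be taken from the nonzerodivisors of \<open>R\<close> by \<open>lift_nonzerodivisor\<close> below.
\<close>

definition weakly_F_regular_at :: "nat \<Rightarrow> ('a, 'b) ring_scheme \<Rightarrow> 'a set \<Rightarrow> bool" where
  "weakly_F_regular_at p R S \<longleftrightarrow> (\<forall>I z c e\<^sub>0. ideal I R \<longrightarrow> z \<in> carrier R \<longrightarrow> c \<in> nonzerodivisors R \<longrightarrow>
     (\<forall>e\<ge>e\<^sub>0. \<exists>s\<in>S. s \<otimes>\<^bsub>R\<^esub> (c \<otimes>\<^bsub>R\<^esub> z [^]\<^bsub>R\<^esub> (p ^ e)) \<in> bracket_power R I (p ^ e)) \<longrightarrow>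
     (\<exists>s\<in>S. s \<otimes>\<^bsub>R\<^esub> z \<in> I))"

lemma weakly_F_regular_atD:
  assumes "weakly_F_regular_at p R S" "ideal I R" "z \<in> carrier R" "c \<in> nonzerodivisors R"
    and "\<forall>e\<ge>e\<^sub>0. \<exists>s\<in>S. s \<otimes>\<^bsub>R\<^esub> (c \<otimes>\<^bsub>R\<^esub> z [^]\<^bsub>R\<^esub> (p ^ e)) \<in> bracket_power R I (p ^ e)"
  shows "\<exists>s\<in>S. s \<otimes>\<^bsub>R\<^esub> z \<in> I"
  by (rule assms(1)[unfolded weakly_F_regular_at_def, THEN spec[of _ I], THEN spec[of _ z],
        THEN spec[of _ c], THEN spec[of _ e\<^sub>0], THEN mp, OF assms(2), THEN mp, OF assms(3),
        THEN mp, OF assms(4), THEN mp, OF assms(5)])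

lemma (in cring) ideal_bracket_power:
  assumes "ideal I R"
  shows "ideal (bracket_power R I q) R"
  unfolding bracket_power_def by (rule genideal_ideal) (use ideal_props(6)[OF assms] in auto)

lemma (in cring) power_mem_bracket_power:
  assumes "ideal I R" "a \<in> I"
  shows "a [^] q \<in> bracket_power R I q"
proof -
  have "{x [^] q | x. x \<in> I} \<subseteq> carrier R" using ideal_props(6)[OF assms(1)] by auto
  from genideal_self[OF this] show ?thesis unfolding bracket_power_def using assms(2) by auto
qed

lemma (in cring) bracket_power_mono:
  assumes "ideal J R" "I \<subseteq> J"
  shows "bracket_power R I q \<subseteq> bracket_power R J q"
proof -
  have "{x [^] q | x. x \<in> I} \<subseteq> bracket_power R J q"
    using power_mem_bracket_power[OF assms(1)] assms(2) by auto
  then show ?thesis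
    unfolding bracket_power_def[of R I] by (rule genideal_minimal[OF ideal_bracket_power[OF assms(1)]])
qed

lemma (in cring) power_add_multiple:
  assumes "x \<in> carrier R" "r \<in> carrier R" "s \<in> carrier R"
  shows "\<exists>v\<in>carrier R. (x \<oplus> r \<otimes> s) [^] (k::nat) = x [^] k \<oplus> v \<otimes> s"
proof (induction k)
  case 0 show ?case using assms by (intro bexI[of _ \<zero>]) auto
next
  case (Suc k)
  then obtain v where v: "v \<in> carrier R" "(x \<oplus> r \<otimes> s) [^] k = x [^] k \<oplus> v \<otimes> s" by blast
  have "(x [^] k \<oplus> v \<otimes> s) \<otimes> (x \<oplus> r \<otimes> s) =
    x [^] k \<otimes> x \<oplus> (x [^] k \<otimes> r \<oplus> v \<otimes> x \<oplus> v \<otimes> s \<otimes> r) \<otimes> s"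
    using assms v(1) nat_pow_closed[OF assms(1), of k] by algebra
  then show ?case using v assms by (intro bexI[of _ "x [^] k \<otimes> r \<oplus> v \<otimes> x \<oplus> v \<otimes> s \<otimes> r"]) auto
qed

context noetherian_cring
begin

text \<open>
  If no element of \<open>S\<close> maps \<open>z\<close> into \<open>I\<close>, a prime \<open>P\<close> that contains \<open>I : z\<close> and avoids \<open>S\<close> witnesses
  the same failure for the larger multiplicative set \<open>R - P\<close>.
\<close>

lemma weakly_F_regular_at_from_primes:
  assumes S: "submonoid S R"
    and primes: "\<And>P. primeideal P R \<Longrightarrow> weakly_F_regular_at p R (carrier R - P)"
  shows "weakly_F_regular_at p R S"
  unfolding weakly_F_regular_at_def
proof (intro allI impI)
  fix I z c e\<^sub>0
  assume I: "ideal I R" and z: "z \<in> carrier R" and c: "c \<in> nonzerodivisors R"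
    and mem: "\<forall>e\<ge>e\<^sub>0. \<exists>s\<in>S. s \<otimes> (c \<otimes> z [^] (p ^ e)) \<in> bracket_power R I (p ^ e)"
  show "\<exists>s\<in>S. s \<otimes> z \<in> I"
  proof (rule ccontr)
    assume no: "\<not> (\<exists>s\<in>S. s \<otimes> z \<in> I)"
    then have "colon R I z \<inter> S = {}" unfolding colon_def by auto
    then obtain P where P: "primeideal P R" "colon R I z \<subseteq> P" "P \<inter> S = {}"
      by (rule exists_prime_disjoint[OF ideal_colon[OF I z] S])
    have SP: "S \<subseteq> carrier R - P" using P(3) submonoid.subset[OF S] by auto
    have "\<forall>e\<ge>e\<^sub>0. \<exists>s\<in>carrier R - P. s \<otimes> (c \<otimes> z [^] (p ^ e)) \<in> bracket_power R I (p ^ e)"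
      using mem SP by (meson subsetD)
    then have "\<exists>s\<in>carrier R - P. s \<otimes> z \<in> I"
      by (rule weakly_F_regular_atD[OF primes[OF P(1)] I z c])
    then show False using P(2) unfolding colon_def by auto
  qed
qed

text \<open>
  Here \<open>P\<close> corresponds to a maximal ideal of \<open>S\<inverse>R\<close>. In a counterexample \<open>I : z \<subseteq> P\<close>; enlarge \<open>I\<close> to an
  ideal \<open>I'\<close> that is maximal with \<open>I' : z \<subseteq> P\<close>. Then \<open>z\<close> generates the socle of \<open>R\<^sub>P / I' R\<^sub>P\<close>, and every element of \<open>P\<close> has a
  power in \<open>I'\<close>. Hence a multiplier outside \<open>P\<close> is already invertible modulo \<open>I'\<^sup>[\<^sup>q\<^sup>]\<close> over \<open>S\<inverse>R\<close>
  and can be replaced by one in \<open>S\<close>.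
\<close>

lemma weakly_F_regular_at_maximal_prime:
  assumes S: "submonoid S R" and wfr: "weakly_F_regular_at p R S"
    and P: "primeideal P R" "P \<inter> S = {}"
    and max: "\<And>s. s \<in> carrier R - P \<Longrightarrow> \<exists>t\<in>S. t \<in> adjoin P s"
  shows "weakly_F_regular_at p R (carrier R - P)"
  unfolding weakly_F_regular_at_def
proof (intro allI impI)
  fix I z c e\<^sub>0
  assume I: "ideal I R" and z: "z \<in> carrier R" and c: "c \<in> nonzerodivisors R"
    and mem: "\<forall>e\<ge>e\<^sub>0. \<exists>s\<in>carrier R - P. s \<otimes> (c \<otimes> z [^] (p ^ e)) \<in> bracket_power R I (p ^ e)"
  have cc: "c \<in> carrier R" using c unfolding nonzerodivisors_def by simp
  note idP = prime_props(1)[OF P(1)]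
  show "\<exists>s\<in>carrier R - P. s \<otimes> z \<in> I"
  proof (rule ccontr)
    assume no: "\<not> (\<exists>s\<in>carrier R - P. s \<otimes> z \<in> I)"
    define F where "F = {J. ideal J R \<and> I \<subseteq> J \<and> colon R J z \<subseteq> P}"
    have IF: "I \<in> F" using no I unfolding F_def colon_def by auto
    have "\<exists>M\<in>F. \<forall>J\<in>F. M \<subseteq> J \<longrightarrow> J = M"
      by (rule exists_maximal_ideal_in_family) (use IF in \<open>auto simp: F_def\<close>)
    then obtain I' where I'F: "I' \<in> F" and I'max: "\<forall>J\<in>F. I' \<subseteq> J \<longrightarrow> J = I'" by (rule bexE)
    then have I': "ideal I' R" "I \<subseteq> I'" "colon R I' z \<subseteq> P" unfolding F_def by auto
    have escape: "\<exists>s\<in>carrier R - P. s \<otimes> z \<in> adjoin I' w"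
      if w: "w \<in> carrier R" "w \<notin> I'" for w
    proof -
      have "adjoin I' w \<noteq> I'" using mem_adjoin_self[OF I'(1) w(1)] w(2) by auto
      then have "adjoin I' w \<notin> F" using I'max subset_adjoin[OF I'(1) w(1)] by auto
      then show ?thesis
        unfolding F_def colon_def
        using ideal_adjoin[OF I'(1) w(1)] subset_adjoin[OF I'(1) w(1)] I'(2) by auto
    qed
    have socle: "x \<otimes> z \<in> I'" if x: "x \<in> P" for x
    proof (rule ccontr)
      assume "x \<otimes> z \<notin> I'"
      have xc: "x \<in> carrier R" using ideal_props(6)[OF idP x] .
      obtain s i r where s: "s \<in> carrier R" "s \<notin> P" "i \<in> I'" "r \<in> carrier R" "s \<otimes> z = i \<oplus> r \<otimes> (x \<otimes> z)"
        using escape[of "x \<otimes> z"] xc z \<open>x \<otimes> z \<notin> I'\<close> unfolding mem_adjoin_iff by auto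
      have ic: "i \<in> carrier R" using ideal_props(6)[OF I'(1) s(3)] .
      have "(s \<ominus> r \<otimes> x) \<otimes> z = s \<otimes> z \<ominus> r \<otimes> (x \<otimes> z)" using s(1,4) xc z by algebra
      also have "\<dots> = i" unfolding s(5) using ic s(4) xc z by algebra
      finally have "s \<ominus> r \<otimes> x \<in> colon R I' z" using s xc unfolding colon_def by simp
      then have "s \<ominus> r \<otimes> x \<in> P" using I'(3) by blast
      moreover have "r \<otimes> x \<in> P" using ideal_props(4)[OF idP s(4) x] .
      moreover have "s = (s \<ominus> r \<otimes> x) \<oplus> r \<otimes> x" using s(1,4) xc by algebra
      ultimately show False using ideal_props(3)[OF idP] s(2) by metis
    qed
    have nilp: "\<exists>n::nat. x [^] n \<in> I'" if x: "x \<in> P" for x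
    proof -
      have xc: "x \<in> carrier R" using ideal_props(6)[OF idP x] .
      note xn = nat_pow_closed[OF xc]
      have "\<exists>n::nat. \<forall>m\<ge>n. colon R I' (x [^] m) = colon R I' (x [^] n)"
      proof (rule ascending_ideals_stabilize)
        show "ideal (colon R I' (x [^] n)) R" for n :: nat by (rule ideal_colon[OF I'(1) xn])
        show "colon R I' (x [^] n) \<subseteq> colon R I' (x [^] Suc n)" for n :: nat
        proof
          fix r assume "r \<in> colon R I' (x [^] n)"
          then have r: "r \<in> carrier R" "r \<otimes> x [^] n \<in> I'" unfolding colon_def by auto
          have "r \<otimes> (x [^] n \<otimes> x) = x \<otimes> (r \<otimes> x [^] n)" using r(1) xc xn[of n] by algebra
          then show "r \<in> colon R I' (x [^] Suc n)"
            using ideal_props(4)[OF I'(1) xc r(2)] r(1) unfolding colon_def by simp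
        qed
      qed
      then obtain n :: nat where n: "\<And>m. m \<ge> n \<Longrightarrow> colon R I' (x [^] m) = colon R I' (x [^] n)" by blast
      \<comment> \<open>Past this point \<open>I' : x\<^sup>m\<close> no longer grows, and \<open>(I' + (x\<^sup>m)) \<inter> (I' : x\<^sup>m) = I'\<close>.
          One more factor \<open>x\<close> ensures that the power kills \<open>z\<close> modulo \<open>I'\<close> even when \<open>n = 0\<close>.\<close>
      define X where "X = x [^] Suc n"
      have Xc: "X \<in> carrier R" unfolding X_def by (rule xn)
      have "X \<in> I'"
      proof (rule ccontr)
        assume "X \<notin> I'"
        then obtain s i r where s: "s \<in> carrier R" "s \<notin> P" "i \<in> I'" "r \<in> carrier R" "s \<otimes> z = i \<oplus> r \<otimes> X"
          using escape[of X] Xc unfolding mem_adjoin_iff by auto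
        have ic: "i \<in> carrier R" using ideal_props(6)[OF I'(1) s(3)] .
        have "X \<otimes> (s \<otimes> z) = (x [^] n \<otimes> s) \<otimes> (x \<otimes> z)"
          unfolding X_def using xn[of n] s(1) xc z by (simp, algebra)
        then have "X \<otimes> (s \<otimes> z) \<in> I'"
          using ideal_props(4)[OF I'(1) _ socle[OF x], of "x [^] n \<otimes> s"] xn[of n] s(1) by simp
        moreover have "X \<otimes> (s \<otimes> z) = X \<otimes> i \<oplus> r \<otimes> (X \<otimes> X)"
          unfolding s(5) using Xc ic s(4) by algebra
        ultimately have "X \<otimes> i \<oplus> r \<otimes> (X \<otimes> X) \<in> I'" by simp
        then have "r \<otimes> (X \<otimes> X) \<in> I'"
          by (rule ideal_cancel_left[OF I'(1)]) (use ideal_props(4)[OF I'(1) Xc s(3)] s(4) Xc in auto)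
        moreover have "X \<otimes> X = x [^] (Suc n + Suc n)"
          unfolding X_def by (rule nat_pow_mult[OF xc])
        ultimately have "r \<in> colon R I' (x [^] (Suc n + Suc n))"
          using s(4) unfolding colon_def by simp
        then have "r \<in> colon R I' X"
          unfolding X_def using n[of "Suc n + Suc n"] n[of "Suc n"] by simp
        then have "r \<otimes> X \<in> I'" unfolding colon_def by simp
        then have "s \<otimes> z \<in> I'" using ideal_props(3)[OF I'(1) s(3)] s(5) by simp
        then have "s \<in> colon R I' z" using s(1) unfolding colon_def by simp
        then show False using I'(3) s(2) by blast
      qed
      then show ?thesis unfolding X_def by blast
    qed
    have "\<exists>t\<in>S. t \<otimes> (c \<otimes> z [^] (p ^ e)) \<in> bracket_power R I' (p ^ e)" if e: "e \<ge> e\<^sub>0" for e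
    proof -
      let ?q = "p ^ e" and ?B = "bracket_power R I' (p ^ e)"
      have B: "ideal ?B R" by (rule ideal_bracket_power[OF I'(1)])
      obtain s where s: "s \<in> carrier R" "s \<notin> P" "s \<otimes> (c \<otimes> z [^] ?q) \<in> bracket_power R I ?q"
        using mem e by auto
      define w where "w = c \<otimes> z [^] ?q"
      have wc: "w \<in> carrier R" unfolding w_def using cc z by simp
      have sw: "s \<otimes> w \<in> ?B" using s(3) bracket_power_mono[OF I'(1,2)] unfolding w_def by blast
      obtain t x r where t: "t \<in> S" "x \<in> P" "r \<in> carrier R" "t = x \<oplus> r \<otimes> s"
        using max[of s] s unfolding mem_adjoin_iff by auto
      have xc: "x \<in> carrier R" using ideal_props(6)[OF idP t(2)] .
      obtain n :: nat where n: "x [^] n \<in> I'" using nilp[OF t(2)] by blast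
      obtain v where v: "v \<in> carrier R" "t [^] (n * ?q) = x [^] (n * ?q) \<oplus> v \<otimes> s"
        using power_add_multiple[OF xc t(3) s(1)] unfolding t(4) by blast
      have xq: "x [^] (n * ?q) \<in> ?B"
        using power_mem_bracket_power[OF I'(1) n, of ?q] nat_pow_pow[OF xc] by simp
      have xqc: "x [^] (n * ?q) \<in> carrier R" using xc by simp
      have "t [^] (n * ?q) \<otimes> w = w \<otimes> x [^] (n * ?q) \<oplus> v \<otimes> (s \<otimes> w)"
        unfolding v(2) using xqc v(1) s(1) wc by algebra
      also have "\<dots> \<in> ?B"
        by (rule ideal_props(3)[OF B ideal_props(4)[OF B wc xq] ideal_props(4)[OF B v(1) sw]])
      finally have "t [^] (n * ?q) \<otimes> w \<in> ?B" .
      moreover have "t [^] k \<in> S" for k :: nat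
        by (induction k) (use t(1) submonoid.m_closed[OF S] submonoid.one_closed[OF S] in auto)
      ultimately show ?thesis unfolding w_def by blast
    qed
    then have "\<exists>t\<in>S. t \<otimes> z \<in> I'"
      by (intro weakly_F_regular_atD[OF wfr I'(1) z c, of e\<^sub>0]) blast
    then obtain t where "t \<in> S" "t \<otimes> z \<in> I'" by blast
    then have "t \<in> colon R I' z" using submonoid.mem_carrier[OF S] unfolding colon_def by simp
    then show False using I'(3) P(2) \<open>t \<in> S\<close> by blast
  qed
qed

end

section \<open>Localizations up to isomorphism\<close>

text \<open>
  These properties determine \<open>A\<close> up to isomorphism as the localization of \<open>R\<close> at \<open>S\<close>, without fixing
  what its elements are. They cover the ring of fractions itself, its copies in other types, \<open>R\<close> as
  its own localization at \<open>{1}\<close>, and iterated localizations.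
\<close>

locale localization_map = R: cring R + A: cring A + S: submonoid S R
  for R (structure) and A and S and \<phi> +
  assumes hom: "\<phi> \<in> ring_hom R A"
    and units: "s \<in> S \<Longrightarrow> \<phi> s \<in> Units A"
    and fractions: "a \<in> carrier A \<Longrightarrow> \<exists>s\<in>S. \<exists>r\<in>carrier R. \<phi> s \<otimes>\<^bsub>A\<^esub> a = \<phi> r"
    and kernel: "r \<in> carrier R \<Longrightarrow> \<phi> r = \<zero>\<^bsub>A\<^esub> \<longleftrightarrow> (\<exists>s\<in>S. s \<otimes> r = \<zero>)"

sublocale localization_map \<subseteq> \<phi>: ring_hom_cring R A \<phi>
  by (intro ring_hom_cring.intro ring_hom_cring_axioms.intro R.is_cring A.is_cring hom)

context localization_map
begin

lemma image_power [simp]: "r \<in> carrier R \<Longrightarrow> \<phi> (r [^] (n::nat)) = \<phi> r [^]\<^bsub>A\<^esub> n"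
  by (induction n) auto

lemma unit_cancel:
  "s \<in> S \<Longrightarrow> a \<in> carrier A \<Longrightarrow> b \<in> carrier A \<Longrightarrow> \<phi> s \<otimes>\<^bsub>A\<^esub> a = \<phi> s \<otimes>\<^bsub>A\<^esub> b \<Longrightarrow> a = b"
  using units A.Units_l_cancel by blast

lemma unit_cancel_ideal:
  assumes "ideal J A" "s \<in> S" "a \<in> carrier A" "\<phi> s \<otimes>\<^bsub>A\<^esub> a \<in> J"
  shows "a \<in> J"
proof -
  have u: "\<phi> s \<in> Units A" using units assms(2) .
  have "a = (inv\<^bsub>A\<^esub> (\<phi> s) \<otimes>\<^bsub>A\<^esub> \<phi> s) \<otimes>\<^bsub>A\<^esub> a" using u assms(3) by simp
  also have "\<dots> = inv\<^bsub>A\<^esub> (\<phi> s) \<otimes>\<^bsub>A\<^esub> (\<phi> s \<otimes>\<^bsub>A\<^esub> a)"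
    by (rule A.m_assoc) (use u assms(3) in auto)
  finally show ?thesis using A.ideal_props(4)[OF assms(1) A.Units_inv_closed[OF u] assms(4)] by simp
qed

lemma image_eq_iff:
  assumes "r \<in> carrier R" "r' \<in> carrier R"
  shows "\<phi> r = \<phi> r' \<longleftrightarrow> (\<exists>s\<in>S. s \<otimes> r = s \<otimes> r')"
proof -
  have m: "\<phi> (r \<ominus> r') = \<phi> r \<ominus>\<^bsub>A\<^esub> \<phi> r'" using assms by (simp add: a_minus_def)
  have "\<phi> r = \<phi> r' \<longleftrightarrow> \<phi> (r \<ominus> r') = \<zero>\<^bsub>A\<^esub>"
    unfolding m using assms by (metis A.r_right_minus_eq \<phi>.hom_closed)
  also have "\<dots> \<longleftrightarrow> (\<exists>s\<in>S. s \<otimes> (r \<ominus> r') = \<zero>)" by (rule kernel) (use assms in simp)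
  also have "\<dots> \<longleftrightarrow> (\<exists>s\<in>S. s \<otimes> r = s \<otimes> r')"
  proof (intro bex_cong refl)
    fix s assume "s \<in> S"
    then have sc: "s \<in> carrier R" by simp
    have "s \<otimes> (r \<ominus> r') = s \<otimes> r \<ominus> s \<otimes> r'" using sc assms by algebra
    then show "s \<otimes> (r \<ominus> r') = \<zero> \<longleftrightarrow> s \<otimes> r = s \<otimes> r'" using sc assms by simp
  qed
  finally show ?thesis .
qed

definition extension :: "'a set \<Rightarrow> 'c set" where
  "extension I = {a \<in> carrier A. \<exists>s\<in>S. \<exists>i\<in>I. \<phi> s \<otimes>\<^bsub>A\<^esub> a = \<phi> i}"

definition contraction :: "'c set \<Rightarrow> 'a set" where
  "contraction J = {r \<in> carrier R. \<phi> r \<in> J}"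

lemma ideal_contraction:
  assumes "ideal J A"
  shows "ideal (contraction J) R"
  unfolding contraction_def
  by (rule R.ideal_by_closure) (use A.ideal_props[OF assms] in auto)

lemma ideal_extension:
  assumes "ideal I R"
  shows "ideal (extension I) A"
  unfolding extension_def
proof (rule A.ideal_by_closure)
  note I = R.ideal_props[OF assms]
  show "\<zero>\<^bsub>A\<^esub> \<in> {a \<in> carrier A. \<exists>s\<in>S. \<exists>i\<in>I. \<phi> s \<otimes>\<^bsub>A\<^esub> a = \<phi> i}"
    by (intro CollectI conjI A.zero_closed bexI[OF _ S.one_closed] bexI[OF _ I(2)]) simp
  fix a b
  assume "a \<in> {a \<in> carrier A. \<exists>s\<in>S. \<exists>i\<in>I. \<phi> s \<otimes>\<^bsub>A\<^esub> a = \<phi> i}"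
    "b \<in> {a \<in> carrier A. \<exists>s\<in>S. \<exists>i\<in>I. \<phi> s \<otimes>\<^bsub>A\<^esub> a = \<phi> i}"
  then obtain s i t j where *: "a \<in> carrier A" "b \<in> carrier A" "s \<in> S" "i \<in> I" "t \<in> S" "j \<in> I"
    "\<phi> s \<otimes>\<^bsub>A\<^esub> a = \<phi> i" "\<phi> t \<otimes>\<^bsub>A\<^esub> b = \<phi> j" by blast
  have c: "s \<in> carrier R" "t \<in> carrier R" "i \<in> carrier R" "j \<in> carrier R"
    using * I(6) S.mem_carrier by auto
  have "\<phi> (s \<otimes> t) \<otimes>\<^bsub>A\<^esub> (a \<oplus>\<^bsub>A\<^esub> b) =
    \<phi> t \<otimes>\<^bsub>A\<^esub> (\<phi> s \<otimes>\<^bsub>A\<^esub> a) \<oplus>\<^bsub>A\<^esub> \<phi> s \<otimes>\<^bsub>A\<^esub> (\<phi> t \<otimes>\<^bsub>A\<^esub> b)"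
    unfolding \<phi>.hom_mult[OF c(1,2)] using *(1,2) c(1,2)[THEN \<phi>.hom_closed] by algebra
  also have "\<dots> = \<phi> (t \<otimes> i \<oplus> s \<otimes> j)" unfolding *(7,8) using c by simp
  finally have "\<phi> (s \<otimes> t) \<otimes>\<^bsub>A\<^esub> (a \<oplus>\<^bsub>A\<^esub> b) = \<phi> (t \<otimes> i \<oplus> s \<otimes> j)" .
  moreover have "t \<otimes> i \<oplus> s \<otimes> j \<in> I" by (intro I(3) I(4)) (use * c in auto)
  moreover have "s \<otimes> t \<in> S" using * by simp
  ultimately show "a \<oplus>\<^bsub>A\<^esub> b \<in> {a \<in> carrier A. \<exists>s\<in>S. \<exists>i\<in>I. \<phi> s \<otimes>\<^bsub>A\<^esub> a = \<phi> i}" using *(1,2) by auto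
next
  note I = R.ideal_props[OF assms]
  fix b a assume b: "b \<in> carrier A" and "a \<in> {a \<in> carrier A. \<exists>s\<in>S. \<exists>i\<in>I. \<phi> s \<otimes>\<^bsub>A\<^esub> a = \<phi> i}"
  then obtain s i where *: "a \<in> carrier A" "s \<in> S" "i \<in> I" "\<phi> s \<otimes>\<^bsub>A\<^esub> a = \<phi> i" by blast
  obtain t r where **: "t \<in> S" "r \<in> carrier R" "\<phi> t \<otimes>\<^bsub>A\<^esub> b = \<phi> r" using fractions[OF b] by blast
  have c: "s \<in> carrier R" "t \<in> carrier R" "i \<in> carrier R"
    using * ** I(6) S.mem_carrier by auto
  have "\<phi> (t \<otimes> s) \<otimes>\<^bsub>A\<^esub> (b \<otimes>\<^bsub>A\<^esub> a) = (\<phi> t \<otimes>\<^bsub>A\<^esub> b) \<otimes>\<^bsub>A\<^esub> (\<phi> s \<otimes>\<^bsub>A\<^esub> a)"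
    unfolding \<phi>.hom_mult[OF c(2,1)] using *(1) b c(1,2)[THEN \<phi>.hom_closed] by algebra
  also have "\<dots> = \<phi> (r \<otimes> i)" unfolding *(4) **(3) using c **(2) by simp
  finally have "\<phi> (t \<otimes> s) \<otimes>\<^bsub>A\<^esub> (b \<otimes>\<^bsub>A\<^esub> a) = \<phi> (r \<otimes> i)" .
  moreover have "r \<otimes> i \<in> I" using I(4) * ** by simp
  moreover have "t \<otimes> s \<in> S" using * ** by simp
  ultimately show "b \<otimes>\<^bsub>A\<^esub> a \<in> {a \<in> carrier A. \<exists>s\<in>S. \<exists>i\<in>I. \<phi> s \<otimes>\<^bsub>A\<^esub> a = \<phi> i}" using *(1) b by auto
qed auto

lemma extension_contraction:
  assumes "ideal J A"
  shows "extension (contraction J) = J"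
proof safe
  fix a assume "a \<in> extension (contraction J)"
  then show "a \<in> J" using unit_cancel_ideal[OF assms] unfolding extension_def contraction_def by auto
next
  fix a assume a: "a \<in> J"
  have ac: "a \<in> carrier A" using A.ideal_props(6)[OF assms a] .
  obtain s r where *: "s \<in> S" "r \<in> carrier R" "\<phi> s \<otimes>\<^bsub>A\<^esub> a = \<phi> r" using fractions[OF ac] by blast
  have "\<phi> s \<otimes>\<^bsub>A\<^esub> a \<in> J" by (rule A.ideal_props(4)[OF assms _ a]) (use *(1) in simp)
  then show "a \<in> extension (contraction J)"
    unfolding extension_def contraction_def using * ac by auto
qed

lemma image_mem_extension_iff:
  assumes "ideal I R" "r \<in> carrier R"
  shows "\<phi> r \<in> extension I \<longleftrightarrow> (\<exists>s\<in>S. s \<otimes> r \<in> I)"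
proof
  assume "\<phi> r \<in> extension I"
  then obtain s i where *: "s \<in> S" "i \<in> I" "\<phi> s \<otimes>\<^bsub>A\<^esub> \<phi> r = \<phi> i" unfolding extension_def by blast
  have c: "s \<in> carrier R" "i \<in> carrier R" using * R.ideal_props(6)[OF assms(1)] by auto
  have "\<phi> (s \<otimes> r) = \<phi> i" using * c assms(2) by simp
  then obtain t where t: "t \<in> S" "t \<otimes> (s \<otimes> r) = t \<otimes> i"
    using image_eq_iff[of "s \<otimes> r" i] c assms(2) by (auto simp del: \<phi>.hom_mult)
  have "(t \<otimes> s) \<otimes> r \<in> I"
    using R.ideal_props(4)[OF assms(1) _ *(2), of t] t c assms(2) by (simp add: R.m_assoc)
  then show "\<exists>s\<in>S. s \<otimes> r \<in> I" using t(1) *(1) S.m_closed by blast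
next
  assume "\<exists>s\<in>S. s \<otimes> r \<in> I"
  then obtain s where s: "s \<in> S" "s \<otimes> r \<in> I" by blast
  then have "\<phi> s \<otimes>\<^bsub>A\<^esub> \<phi> r = \<phi> (s \<otimes> r)" using assms(2) by simp
  then show "\<phi> r \<in> extension I"
    unfolding extension_def using s \<phi>.hom_closed[OF assms(2)] by blast
qed

text \<open>
  Frobenius powers commute with localization because \<open>S\<close> is closed under \<open>q\<close>-th powers: from
  \<open>\<phi> s a = \<phi> i\<close> follows \<open>\<phi> (s\<^sup>q) a\<^sup>q = \<phi> (i\<^sup>q)\<close>.
\<close>

lemma bracket_power_extension:
  assumes I: "ideal I R"
  shows "bracket_power A (extension I) q = extension (bracket_power R I q)"
proof
  have B: "ideal (bracket_power R I q) R" by (rule R.ideal_bracket_power[OF I])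
  have EI: "ideal (extension I) A" by (rule ideal_extension[OF I])
  have B': "ideal (bracket_power A (extension I) q) A" by (rule A.ideal_bracket_power[OF EI])
  show "bracket_power A (extension I) q \<subseteq> extension (bracket_power R I q)"
    unfolding bracket_power_def[of A]
  proof (rule A.genideal_minimal[OF ideal_extension[OF B]], safe)
    fix a assume "a \<in> extension I"
    then obtain s i where *: "a \<in> carrier A" "s \<in> S" "i \<in> I" "\<phi> s \<otimes>\<^bsub>A\<^esub> a = \<phi> i"
      unfolding extension_def by blast
    have ic: "i \<in> carrier R" using R.ideal_props(6)[OF I *(3)] .
    have sq: "s [^] q \<in> S" by (induction q) (use *(2) in auto)
    have "\<phi> (s [^] q) \<otimes>\<^bsub>A\<^esub> a [^]\<^bsub>A\<^esub> q = (\<phi> s \<otimes>\<^bsub>A\<^esub> a) [^]\<^bsub>A\<^esub> q"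
      using *(1,2) by (simp add: A.nat_pow_distrib)
    also have "\<dots> = \<phi> (i [^] q)" unfolding *(4) using ic by simp
    finally show "a [^]\<^bsub>A\<^esub> q \<in> extension (bracket_power R I q)"
      unfolding extension_def using sq R.power_mem_bracket_power[OF I *(3)] *(1) by auto
  qed
  have "bracket_power R I q \<subseteq> contraction (bracket_power A (extension I) q)"
    unfolding bracket_power_def[of R]
  proof (rule R.genideal_minimal[OF ideal_contraction[OF B']], safe)
    fix i assume i: "i \<in> I"
    have ic: "i \<in> carrier R" using R.ideal_props(6)[OF I i] .
    have "\<one> \<otimes> i \<in> I" using i ic by simp
    then have "\<phi> i \<in> extension I" using image_mem_extension_iff[OF I ic] S.one_closed by blast
    then have "\<phi> i [^]\<^bsub>A\<^esub> q \<in> bracket_power A (extension I) q" by (rule A.power_mem_bracket_power[OF EI])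
    then show "i [^] q \<in> contraction (bracket_power A (extension I) q)"
      unfolding contraction_def using ic by simp
  qed
  then have "extension (bracket_power R I q) \<subseteq> extension (contraction (bracket_power A (extension I) q))"
    unfolding extension_def by blast
  then show "extension (bracket_power R I q) \<subseteq> bracket_power A (extension I) q"
    unfolding extension_contraction[OF B'] .
qed

lemma noetherian_target:
  assumes "noetherian_ring R"
  shows "noetherian_ring A"
proof (rule A.noetherian_ringI)
  interpret N: noetherian_ring R by fact
  fix J assume J: "ideal J A"
  obtain F where F: "F \<subseteq> carrier R" "finite F" "contraction J = Idl F"
    using N.finetely_gen[OF ideal_contraction[OF J]] by blast
  have FA: "\<phi> ` F \<subseteq> carrier A" using F(1) by auto
  have G: "ideal (Idl\<^bsub>A\<^esub> (\<phi> ` F)) A" by (rule A.genideal_ideal[OF FA])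
  have "F \<subseteq> contraction (Idl\<^bsub>A\<^esub> (\<phi> ` F))"
    unfolding contraction_def using F(1) A.genideal_self[OF FA] by auto
  then have "contraction J \<subseteq> contraction (Idl\<^bsub>A\<^esub> (\<phi> ` F))"
    unfolding F(3) by (rule R.genideal_minimal[OF ideal_contraction[OF G]])
  then have "extension (contraction J) \<subseteq> extension (contraction (Idl\<^bsub>A\<^esub> (\<phi> ` F)))"
    unfolding extension_def by blast
  then have "J \<subseteq> Idl\<^bsub>A\<^esub> (\<phi> ` F)"
    unfolding extension_contraction[OF J] extension_contraction[OF G] .
  moreover have "Idl\<^bsub>A\<^esub> (\<phi> ` F) \<subseteq> J"
  proof (rule A.genideal_minimal[OF J])
    have "F \<subseteq> contraction J" unfolding F(3) by (rule R.genideal_self[OF F(1)])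
    then show "\<phi> ` F \<subseteq> J" unfolding contraction_def by auto
  qed
  ultimately show "\<exists>B\<subseteq>carrier A. finite B \<and> J = Idl\<^bsub>A\<^esub> B" using FA F(2) by blast
qed

lemma reduced_target:
  assumes "reduced_ring R"
  shows "reduced_ring A"
  unfolding reduced_ring_def
proof (intro ballI allI impI)
  fix a n assume a: "a \<in> carrier A" "a [^]\<^bsub>A\<^esub> (n::nat) = \<zero>\<^bsub>A\<^esub>"
  obtain s r where *: "s \<in> S" "r \<in> carrier R" "\<phi> s \<otimes>\<^bsub>A\<^esub> a = \<phi> r" using fractions[OF a(1)] by blast
  have "\<phi> (r [^] n) = (\<phi> s \<otimes>\<^bsub>A\<^esub> a) [^]\<^bsub>A\<^esub> n" unfolding *(3) using *(2) by simp
  also have "\<dots> = \<zero>\<^bsub>A\<^esub>" using *(1) a by (simp add: A.nat_pow_distrib)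
  finally obtain t where t: "t \<in> S" "t \<otimes> r [^] n = \<zero>" using kernel[of "r [^] n"] *(2) by auto
  have tc: "t \<in> carrier R" using t by simp
  have "(t \<otimes> r) [^] Suc n = (t [^] n \<otimes> r) \<otimes> (t \<otimes> r [^] n)"
    using tc *(2) by (simp add: R.nat_pow_distrib R.m_ac)
  also have "\<dots> = \<zero>" unfolding t(2) using tc *(2) by simp
  finally have "t \<otimes> r = \<zero>" using assms tc *(2) unfolding reduced_ring_def by blast
  then have "\<phi> r = \<zero>\<^bsub>A\<^esub>" using kernel *(2) t(1) by blast
  then have "\<phi> s \<otimes>\<^bsub>A\<^esub> a = \<phi> s \<otimes>\<^bsub>A\<^esub> \<zero>\<^bsub>A\<^esub>" using * by simp
  then show "a = \<zero>\<^bsub>A\<^esub>" using unit_cancel[OF *(1) a(1)] by simp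
qed

lemma image_nonzerodivisor:
  assumes c: "c \<in> nonzerodivisors R"
  shows "\<phi> c \<in> nonzerodivisors A"
  unfolding nonzerodivisors_def
proof safe
  have cc: "c \<in> carrier R" using c unfolding nonzerodivisors_def by simp
  then show "\<phi> c \<in> carrier A" by simp
  fix a assume a: "a \<in> carrier A" "\<phi> c \<otimes>\<^bsub>A\<^esub> a = \<zero>\<^bsub>A\<^esub>"
  obtain s r where *: "s \<in> S" "r \<in> carrier R" "\<phi> s \<otimes>\<^bsub>A\<^esub> a = \<phi> r" using fractions[OF a(1)] by blast
  have "\<phi> (c \<otimes> r) = \<phi> s \<otimes>\<^bsub>A\<^esub> (\<phi> c \<otimes>\<^bsub>A\<^esub> a)"
    using cc * a(1) by (simp add: *(3)[symmetric] A.m_lcomm)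
  also have "\<dots> = \<zero>\<^bsub>A\<^esub>" unfolding a(2) using * by simp
  finally obtain t where t: "t \<in> S" "t \<otimes> (c \<otimes> r) = \<zero>" using kernel[of "c \<otimes> r"] *(2) cc by auto
  have "c \<otimes> (t \<otimes> r) = \<zero>" using t cc *(2) by (simp add: R.m_lcomm)
  then have "t \<otimes> r = \<zero>" using c t *(2) unfolding nonzerodivisors_def by auto
  then have "\<phi> r = \<zero>\<^bsub>A\<^esub>" using kernel *(2) t(1) by blast
  then have "\<phi> s \<otimes>\<^bsub>A\<^esub> a = \<phi> s \<otimes>\<^bsub>A\<^esub> \<zero>\<^bsub>A\<^esub>" using * by simp
  then show "a = \<zero>\<^bsub>A\<^esub>" using unit_cancel[OF *(1) a(1)] by simp
qed

lemma Fp_algebra_target: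
  assumes "Fp_algebra p R"
  shows "Fp_algebra p A"
proof -
  have "\<phi> ([n] \<cdot> \<one>) = [n] \<cdot>\<^bsub>A\<^esub> \<one>\<^bsub>A\<^esub>" for n :: nat
    by (induction n) auto
  then have "[p] \<cdot>\<^bsub>A\<^esub> \<one>\<^bsub>A\<^esub> = \<phi> ([p] \<cdot> \<one>)" by simp
  then show ?thesis using assms A.is_cring unfolding Fp_algebra_def by simp
qed

lemma local_target:
  assumes Q: "primeideal Q R" and S_eq: "S = carrier R - Q"
  shows "local_ring A"
proof -
  note idQ = R.prime_props(1)[OF Q]
  let ?M = "extension Q"
  have M: "ideal ?M A" by (rule ideal_extension[OF idQ])
  have one_notin: "\<one>\<^bsub>A\<^esub> \<notin> ?M"
    using image_mem_extension_iff[OF idQ, of \<one>] S_eq by auto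
  have unit: "a \<in> Units A" if a: "a \<in> carrier A" "a \<notin> ?M" for a
  proof -
    obtain s r where *: "s \<in> S" "r \<in> carrier R" "\<phi> s \<otimes>\<^bsub>A\<^esub> a = \<phi> r" using fractions[OF a(1)] by blast
    have "r \<notin> Q" using a * unfolding extension_def by blast
    then have "\<phi> r \<in> Units A" using units S_eq *(2) by simp
    moreover have "a = inv\<^bsub>A\<^esub> (\<phi> s) \<otimes>\<^bsub>A\<^esub> (\<phi> s \<otimes>\<^bsub>A\<^esub> a)"
      using units[OF *(1)] a(1) by (simp add: A.m_assoc[symmetric] A.Units_closed)
    ultimately show ?thesis using *(3) units[OF *(1)] by auto
  qed
  have sub: "J \<subseteq> ?M" if J: "ideal J A" "J \<noteq> carrier A" for J
  proof
    fix a assume a: "a \<in> J"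
    have ac: "a \<in> carrier A" using A.ideal_props(6)[OF J(1) a] .
    show "a \<in> ?M"
    proof (rule ccontr)
      assume "a \<notin> ?M"
      then have "a \<in> Units A" using unit ac by blast
      then have "\<one>\<^bsub>A\<^esub> \<in> J" using A.ideal_props(4)[OF J(1) A.Units_inv_closed a] by (metis A.Units_l_inv)
      then show False using ideal.one_imp_carrier[OF J(1)] J(2) by simp
    qed
  qed
  have "maximalideal ?M A"
  proof (rule maximalidealI[OF M])
    show "carrier A \<noteq> ?M" using one_notin by auto
    fix J assume "ideal J A" "?M \<subseteq> J" "J \<subseteq> carrier A"
    then show "J = ?M \<or> J = carrier A" using sub by blast
  qed
  moreover have "N = ?M" if N: "maximalideal N A" for N
  proof -
    interpret N: maximalideal N A by fact
    have "N \<subseteq> ?M" using sub[OF N.is_ideal] N.I_notcarr by auto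
    then show ?thesis using N.I_maximal[OF M] A.ideal_props(1)[OF M] one_notin by auto
  qed
  ultimately show ?thesis unfolding local_ring_def using A.is_cring by blast
qed

text \<open>
  A localization is no larger than the ring. For infinite \<open>R\<close> there are only \<open>|R \<times> R| = |R|\<close>
  fractions; for finite \<open>R\<close> multiplication by \<open>\<phi> s\<close> permutes the finite set \<open>\<phi> ` R\<close>, so all
  fractions lie in that set.
\<close>

lemma target_lepoll: "carrier A \<lesssim> carrier R"
proof (cases "finite (carrier R)")
  case True
  have "carrier A \<subseteq> \<phi> ` carrier R"
  proof
    fix a assume a: "a \<in> carrier A"
    obtain s r where *: "s \<in> S" "r \<in> carrier R" "\<phi> s \<otimes>\<^bsub>A\<^esub> a = \<phi> r" using fractions[OF a] by blast
    have "(\<otimes>\<^bsub>A\<^esub>) (\<phi> s) ` (\<phi> ` carrier R) = \<phi> ` carrier R"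
    proof (rule endo_inj_surj)
      show "finite (\<phi> ` carrier R)" using True by simp
      show "(\<otimes>\<^bsub>A\<^esub>) (\<phi> s) ` (\<phi> ` carrier R) \<subseteq> \<phi> ` carrier R"
        using *(1) \<phi>.hom_mult[symmetric] by (auto simp del: \<phi>.hom_mult)
      show "inj_on ((\<otimes>\<^bsub>A\<^esub>) (\<phi> s)) (\<phi> ` carrier R)"
        using unit_cancel[OF *(1)] by (auto intro!: inj_onI)
    qed
    then obtain r' where r': "r' \<in> carrier R" "\<phi> s \<otimes>\<^bsub>A\<^esub> \<phi> r' = \<phi> r" using *(2) by (smt (verit) image_iff)
    then show "a \<in> \<phi> ` carrier R" using unit_cancel[OF *(1) a, of "\<phi> r'"] *(3) by auto
  qed
  then show ?thesis by (meson image_lepoll lepoll_trans subset_imp_lepoll)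
next
  case False
  have "carrier A \<subseteq> (\<lambda>(r, s). inv\<^bsub>A\<^esub> (\<phi> s) \<otimes>\<^bsub>A\<^esub> \<phi> r) ` (carrier R \<times> carrier R)"
  proof
    fix a assume a: "a \<in> carrier A"
    obtain s r where *: "s \<in> S" "r \<in> carrier R" "\<phi> s \<otimes>\<^bsub>A\<^esub> a = \<phi> r" using fractions[OF a] by blast
    have "a = inv\<^bsub>A\<^esub> (\<phi> s) \<otimes>\<^bsub>A\<^esub> \<phi> r"
      unfolding *(3)[symmetric] using units[OF *(1)] a by (simp add: A.m_assoc[symmetric] A.Units_closed)
    then show "a \<in> (\<lambda>(r, s). inv\<^bsub>A\<^esub> (\<phi> s) \<otimes>\<^bsub>A\<^esub> \<phi> r) ` (carrier R \<times> carrier R)"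
      using * by (intro image_eqI[of _ _ "(r, s)"]) auto
  qed
  then have "carrier A \<lesssim> carrier R \<times> carrier R" by (meson image_lepoll lepoll_trans subset_imp_lepoll)
  also have "carrier R \<times> carrier R \<approx> carrier R" 
    using card_of_Times_same_infinite[OF False] unfolding eqpoll_def card_of_ordIso .
  finally show ?thesis .
qed

text \<open>
  Renaming the elements of a localization along an injection \<open>g\<close> gives a localization again. By
  \<open>target_lepoll\<close> there is such a \<open>g\<close> into \<open>R\<close>, and this yields a copy over the type of \<open>R\<close>.
\<close>

lemma localization_map_image_ring:
  assumes g: "inj_on g (carrier A)"
  shows "localization_map R (image_ring g A) S (g \<circ> \<phi>)"
proof -
  let ?B = "image_ring g A"
  have iso: "g \<in> ring_iso A ?B" by (rule inj_imp_image_ring_iso[OF g])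
  have ghom: "g \<in> ring_hom A ?B" using iso unfolding ring_iso_def by simp
  have carB: "carrier ?B = g ` carrier A"
    unfolding image_ring_def image_group_def by (simp add: monoid.defs)
  have zeroB: "\<zero>\<^bsub>?B\<^esub> = g \<zero>\<^bsub>A\<^esub>" unfolding image_ring_def by (simp add: monoid.defs)
  interpret B: ring ?B by (rule A.inj_imp_image_ring_is_ring[OF g])
  have B: "cring ?B"
  proof (rule cringI)
    show "abelian_group ?B" by (rule B.is_abelian_group)
    show "comm_monoid ?B"
    proof (rule B.monoid_comm_monoidI)
      fix x y assume "x \<in> carrier ?B" "y \<in> carrier ?B"
      then obtain a b where "x = g a" "y = g b" "a \<in> carrier A" "b \<in> carrier A" unfolding carB by blast
      then show "x \<otimes>\<^bsub>?B\<^esub> y = y \<otimes>\<^bsub>?B\<^esub> x"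
        using ring_hom_mult[OF ghom, of a b] ring_hom_mult[OF ghom, of b a] A.m_comm[of a b] by simp
    qed
  qed (rule B.l_distr)
  show ?thesis
  proof (intro localization_map.intro localization_map_axioms.intro R.is_cring B S.submonoid_axioms)
    show "g \<circ> \<phi> \<in> ring_hom R ?B" by (rule ring_hom_trans[OF hom ghom])
    fix s assume s: "s \<in> S"
    then have u: "\<phi> s \<in> Units A" by (rule units)
    then have c: "inv\<^bsub>A\<^esub> \<phi> s \<in> carrier A" "\<phi> s \<in> carrier A" by auto
    have "g (\<phi> s) \<otimes>\<^bsub>?B\<^esub> g (inv\<^bsub>A\<^esub> \<phi> s) = \<one>\<^bsub>?B\<^esub>" "g (inv\<^bsub>A\<^esub> \<phi> s) \<otimes>\<^bsub>?B\<^esub> g (\<phi> s) = \<one>\<^bsub>?B\<^esub>"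
      using ring_hom_mult[OF ghom] ring_hom_one[OF ghom] c u by (metis A.Units_r_inv, metis A.Units_l_inv)
    then show "(g \<circ> \<phi>) s \<in> Units ?B" unfolding Units_def using c carB by auto
  next
    fix b assume "b \<in> carrier ?B"
    then obtain a where a: "a \<in> carrier A" "b = g a" unfolding carB by blast
    obtain s r where *: "s \<in> S" "r \<in> carrier R" "\<phi> s \<otimes>\<^bsub>A\<^esub> a = \<phi> r" using fractions[OF a(1)] by blast
    have "(g \<circ> \<phi>) s \<otimes>\<^bsub>?B\<^esub> b = (g \<circ> \<phi>) r"
      unfolding a(2) comp_def using ring_hom_mult[OF ghom, of "\<phi> s" a] * a(1) by simp
    then show "\<exists>s\<in>S. \<exists>r\<in>carrier R. (g \<circ> \<phi>) s \<otimes>\<^bsub>?B\<^esub> b = (g \<circ> \<phi>) r" using * by blast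
  next
    fix r assume r: "r \<in> carrier R"
    have "(g \<circ> \<phi>) r = \<zero>\<^bsub>?B\<^esub> \<longleftrightarrow> \<phi> r = \<zero>\<^bsub>A\<^esub>"
      unfolding zeroB comp_def using inj_on_eq_iff[OF g] r by simp
    then show "(g \<circ> \<phi>) r = \<zero>\<^bsub>?B\<^esub> \<longleftrightarrow> (\<exists>s\<in>S. s \<otimes> r = \<zero>)" using kernel[OF r] by simp
  qed
qed

lemma localization_map_powers:
  assumes x: "x \<in> carrier R" and B: "localization_map A B {\<phi> x [^]\<^bsub>A\<^esub> (n::nat) | n. True} \<psi>"
  shows "localization_map R B {t \<otimes> x [^] (n::nat) | t n. t \<in> S} (\<psi> \<circ> \<phi>)"
proof -
  interpret B: localization_map A B "{\<phi> x [^]\<^bsub>A\<^esub> (n::nat) | n. True}" \<psi> by fact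
  define T where "T = {t \<otimes> x [^] (n::nat) | t n. t \<in> S}"
  have TI: "t \<otimes> x [^] (n::nat) \<in> T" if "t \<in> S" for t n using that unfolding T_def by blast
  have TE: "\<exists>s n. s \<in> S \<and> t = s \<otimes> x [^] (n::nat)" if "t \<in> T" for t using that unfolding T_def by blast
  have pow: "\<phi> x [^]\<^bsub>A\<^esub> n \<in> {\<phi> x [^]\<^bsub>A\<^esub> (n::nat) | n. True}" for n :: nat by blast
  have "localization_map R B T (\<psi> \<circ> \<phi>)"
  proof (intro localization_map.intro localization_map_axioms.intro R.is_cring B.A.is_cring)
    show "submonoid T R"
      unfolding T_def by (rule R.submonoid_times_powers[OF S.submonoid_axioms x])
    show "\<psi> \<circ> \<phi> \<in> ring_hom R B" by (rule ring_hom_trans[OF hom B.hom])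
    fix t assume "t \<in> T"
    then obtain s n where t: "s \<in> S" "t = s \<otimes> x [^] (n::nat)" using TE by blast
    obtain v where v: "v \<in> carrier A" "\<phi> s \<otimes>\<^bsub>A\<^esub> v = \<one>\<^bsub>A\<^esub>"
      using A.Units_r_inv_ex[OF units[OF t(1)]] by blast
    have "\<psi> (\<phi> s) \<otimes>\<^bsub>B\<^esub> \<psi> v = \<psi> (\<phi> s \<otimes>\<^bsub>A\<^esub> v)" using t(1) v(1) by simp
    then have "\<psi> (\<phi> s) \<otimes>\<^bsub>B\<^esub> \<psi> v = \<one>\<^bsub>B\<^esub>" using v(2) by simp
    then have "\<psi> (\<phi> s) \<in> Units B"
      unfolding Units_def using t(1) v(1) B.A.m_comm[of "\<psi> (\<phi> s)" "\<psi> v"] by auto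
    moreover have "\<psi> (\<phi> x [^]\<^bsub>A\<^esub> n) \<in> Units B" by (rule B.units[OF pow])
    moreover have "(\<psi> \<circ> \<phi>) t = \<psi> (\<phi> s) \<otimes>\<^bsub>B\<^esub> \<psi> (\<phi> x [^]\<^bsub>A\<^esub> n)" unfolding t(2) using t(1) x by simp
    ultimately show "(\<psi> \<circ> \<phi>) t \<in> Units B" by simp
  next
    fix b assume b: "b \<in> carrier B"
    obtain n :: nat and a where a: "a \<in> carrier A" "\<psi> (\<phi> x [^]\<^bsub>A\<^esub> n) \<otimes>\<^bsub>B\<^esub> b = \<psi> a"
      using B.fractions[OF b] by blast
    obtain s r where *: "s \<in> S" "r \<in> carrier R" "\<phi> s \<otimes>\<^bsub>A\<^esub> a = \<phi> r" using fractions[OF a(1)] by blast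
    have "(\<psi> \<circ> \<phi>) (s \<otimes> x [^] n) \<otimes>\<^bsub>B\<^esub> b = \<psi> (\<phi> s) \<otimes>\<^bsub>B\<^esub> (\<psi> (\<phi> x [^]\<^bsub>A\<^esub> n) \<otimes>\<^bsub>B\<^esub> b)"
      using *(1) x b by (simp add: B.A.m_assoc)
    also have "\<dots> = \<psi> (\<phi> s \<otimes>\<^bsub>A\<^esub> a)" unfolding a(2) using *(1) a(1) by simp
    finally have "(\<psi> \<circ> \<phi>) (s \<otimes> x [^] n) \<otimes>\<^bsub>B\<^esub> b = (\<psi> \<circ> \<phi>) r" unfolding *(3) by simp
    then show "\<exists>t\<in>T. \<exists>r\<in>carrier R. (\<psi> \<circ> \<phi>) t \<otimes>\<^bsub>B\<^esub> b = (\<psi> \<circ> \<phi>) r" using TI[OF *(1)] *(2) by blast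
  next
    fix r assume r: "r \<in> carrier R"
    have "(\<psi> \<circ> \<phi>) r = \<zero>\<^bsub>B\<^esub> \<longleftrightarrow> (\<exists>n::nat. \<phi> x [^]\<^bsub>A\<^esub> n \<otimes>\<^bsub>A\<^esub> \<phi> r = \<zero>\<^bsub>A\<^esub>)"
      using B.kernel[of "\<phi> r"] r by auto
    also have "\<dots> \<longleftrightarrow> (\<exists>n::nat. \<phi> (x [^] n \<otimes> r) = \<zero>\<^bsub>A\<^esub>)" using x r by simp
    also have "\<dots> \<longleftrightarrow> (\<exists>n::nat. \<exists>s\<in>S. s \<otimes> (x [^] n \<otimes> r) = \<zero>)"
      by (intro ex_cong1 kernel) (use x r in simp)
    also have "\<dots> \<longleftrightarrow> (\<exists>n::nat. \<exists>s\<in>S. (s \<otimes> x [^] n) \<otimes> r = \<zero>)"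
      using x r by (simp add: R.m_assoc cong: bex_cong)
    also have "\<dots> \<longleftrightarrow> (\<exists>t\<in>T. t \<otimes> r = \<zero>)" unfolding T_def by blast
    finally show "(\<psi> \<circ> \<phi>) r = \<zero>\<^bsub>B\<^esub> \<longleftrightarrow> (\<exists>t\<in>T. t \<otimes> r = \<zero>)" .
  qed
  then show ?thesis unfolding T_def .
qed

end

lemma (in cring) localization_map_self: "localization_map R R {\<one>} id"
proof (intro localization_map.intro localization_map_axioms.intro is_cring id_ring_hom)
  show "submonoid {\<one>} R" by unfold_locales auto
qed auto

lemma (in cring_mult_set) localization_map_localization:
  "localization_map R (localization R S) S (\<lambda>a. fraction R S a \<one>)"
proof -
  let ?L = "localization R S"
  have frac0: "fraction R S a s = \<zero>\<^bsub>?L\<^esub> \<longleftrightarrow> (\<exists>u\<in>S. u \<otimes> a = \<zero>)" if "a \<in> carrier R" "s \<in> S" for a s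
    unfolding zero_localization using that fraction_eq_iff[of a s \<zero> \<one>] S_carrier by auto
  show ?thesis
  proof (intro localization_map.intro localization_map_axioms.intro is_cring cring_localization
      submonoid_axioms)
    show "(\<lambda>a. fraction R S a \<one>) \<in> ring_hom R ?L"
      by (rule ring_hom_memI)
        (auto simp: fraction_in_carrier localization_mult localization_add one_localization)
    fix s assume s: "s \<in> S"
    have "fraction R S s \<one> \<otimes>\<^bsub>?L\<^esub> fraction R S \<one> s = \<one>\<^bsub>?L\<^esub>"
      "fraction R S \<one> s \<otimes>\<^bsub>?L\<^esub> fraction R S s \<one> = \<one>\<^bsub>?L\<^esub>"
      using s S_carrier[OF s] fraction_eqI[of s s \<one> \<one>] by (simp_all add: localization_mult one_localization)
    then show "fraction R S s \<one> \<in> Units ?L"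
      unfolding Units_def using s S_carrier[OF s] fraction_in_carrier by auto
  next
    fix a assume "a \<in> carrier ?L"
    then obtain r s where *: "a = fraction R S r s" "r \<in> carrier R" "s \<in> S"
      unfolding carrier_localization by blast
    have "fraction R S s \<one> \<otimes>\<^bsub>?L\<^esub> a = fraction R S r \<one>"
      unfolding *(1) using * S_carrier[OF *(3)] fraction_eqI[of "s \<otimes> r" s r \<one>] by (simp add: localization_mult)
    then show "\<exists>s\<in>S. \<exists>r\<in>carrier R. fraction R S s \<one> \<otimes>\<^bsub>?L\<^esub> a = fraction R S r \<one>" using * by blast
  next
    fix r assume r: "r \<in> carrier R"
    then show "fraction R S r \<one> = \<zero>\<^bsub>?L\<^esub> \<longleftrightarrow> (\<exists>s\<in>S. s \<otimes> r = \<zero>)" using frac0 by simp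
  qed
qed

section \<open>Weak F-regularity of localizations\<close>

lemma (in cring) one_mem_ring_circ: "\<one> \<in> ring_circ R"
  unfolding ring_circ_def minimal_prime_def using prime_props(2) by auto

lemma (in cring) subset_tight_closure:
  assumes "ideal I R"
  shows "I \<subseteq> tight_closure p R I"
proof
  fix z assume z: "z \<in> I"
  have "\<one> \<otimes> z [^] (p ^ e) \<in> bracket_power R I (p ^ e)" for e
    using power_mem_bracket_power[OF assms z] ideal_props(6)[OF assms z] by simp
  then show "z \<in> tight_closure p R I"
    unfolding tight_closure_def using one_mem_ring_circ ideal_props(6)[OF assms z] by blast
qed

text \<open>
  A nilpotent lies in the tight closure of the zero ideal, with multiplier \<open>1\<close>.
\<close>

lemma (in cring) reduced_of_weakly_F_regular:
  assumes p: "p \<ge> 2" and wfr: "weakly_F_regular p R"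
  shows "reduced_ring R"
  unfolding reduced_ring_def
proof (intro ballI allI impI)
  fix x n assume x: "x \<in> carrier R" "x [^] (n::nat) = \<zero>"
  have "\<one> \<otimes> x [^] (p ^ e) \<in> bracket_power R {\<zero>} (p ^ e)" if "e \<ge> n" for e
  proof -
    have "e < p ^ e" using p by (intro power_gt_expt) simp
    then have "x [^] (p ^ e) = x [^] n \<otimes> x [^] (p ^ e - n)"
      using that x(1) by (simp add: nat_pow_mult)
    also have "\<dots> = \<zero>" unfolding x(2) using x(1) by simp
    finally show ?thesis using ideal_props(2)[OF ideal_bracket_power[OF zeroideal]] by simp
  qed
  then have "x \<in> tight_closure p R {\<zero>}"
    unfolding tight_closure_def using one_mem_ring_circ x(1) by blast
  then show "x = \<zero>" using wfr zeroideal unfolding weakly_F_regular_def by auto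
qed

context localization_map
begin

text \<open>
  A multiplier in the localization lifts to a nonzerodivisor of \<open>R\<close>: clear denominators to get some
  \<open>c \<in> R\<close>, and add a summand \<open>d\<close> with \<open>c d = 0\<close>, which vanishes in the localization as \<open>c\<close> is a
  nonzerodivisor there.
\<close>

lemma lift_nonzerodivisor:
  assumes noeth: "noetherian_ring R" and red: "reduced_ring R" and c': "c' \<in> nonzerodivisors A"
  obtains c t where "c \<in> nonzerodivisors R" "t \<in> S" "\<phi> t \<otimes>\<^bsub>A\<^esub> c' = \<phi> c"
proof -
  interpret N: noetherian_cring R
    by (intro noetherian_cring.intro noeth R.is_cring)
  have cc: "c' \<in> carrier A" using c' unfolding nonzerodivisors_def by simp
  obtain t c where t: "t \<in> S" "c \<in> carrier R" "\<phi> t \<otimes>\<^bsub>A\<^esub> c' = \<phi> c" using fractions[OF cc] by blast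
  obtain d where d: "d \<in> carrier R" "c \<otimes> d = \<zero>" "c \<oplus> d \<in> nonzerodivisors R"
    using N.exists_complementary_summand[OF red t(2)] by blast
  have "\<phi> t \<otimes>\<^bsub>A\<^esub> (c' \<otimes>\<^bsub>A\<^esub> \<phi> d) = \<phi> (c \<otimes> d)"
    using t d(1) cc by (simp add: A.m_assoc[symmetric])
  also have "\<dots> = \<phi> t \<otimes>\<^bsub>A\<^esub> \<zero>\<^bsub>A\<^esub>" unfolding d(2) using t(1) by simp
  finally have "c' \<otimes>\<^bsub>A\<^esub> \<phi> d = \<zero>\<^bsub>A\<^esub>" by (rule unit_cancel[OF t(1), rotated 2]) (use cc d(1) in auto)
  then have "\<phi> d = \<zero>\<^bsub>A\<^esub>" using c' d(1) unfolding nonzerodivisors_def by auto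
  then have "\<phi> t \<otimes>\<^bsub>A\<^esub> c' = \<phi> (c \<oplus> d)" using t d(1) by simp
  then show ?thesis using that d(3) t(1) by blast
qed

text \<open>
  Both directions transport a relation \<open>c z\<^sup>q \<in> I\<^sup>[\<^sup>q\<^sup>]\<close> along \<open>\<phi>\<close>, using that ideals of \<open>A\<close> are
  extended from \<open>R\<close> and that extension commutes with Frobenius powers.
\<close>

lemma weakly_F_regular_target_iff:
  assumes noeth: "noetherian_ring R" and red: "reduced_ring R"
  shows "weakly_F_regular p A \<longleftrightarrow> weakly_F_regular_at p R S"
proof
  interpret NA: noetherian_cring A
    by (intro noetherian_cring.intro noetherian_target[OF noeth] A.is_cring)
  have circA: "ring_circ A = nonzerodivisors A" by (rule NA.ring_circ_reduced[OF reduced_target[OF red]])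
  assume wfr: "weakly_F_regular p A"
  show "weakly_F_regular_at p R S"
    unfolding weakly_F_regular_at_def
  proof (intro allI impI)
    fix I z c e\<^sub>0
    assume I: "ideal I R" and z: "z \<in> carrier R" and c: "c \<in> nonzerodivisors R"
      and mem: "\<forall>e\<ge>e\<^sub>0. \<exists>s\<in>S. s \<otimes> (c \<otimes> z [^] (p ^ e)) \<in> bracket_power R I (p ^ e)"
    have cc: "c \<in> carrier R" using c unfolding nonzerodivisors_def by simp
    have "\<phi> c \<otimes>\<^bsub>A\<^esub> \<phi> z [^]\<^bsub>A\<^esub> (p ^ e) \<in> bracket_power A (extension I) (p ^ e)" if "e \<ge> e\<^sub>0" for e
    proof -
      have "\<phi> (c \<otimes> z [^] (p ^ e)) \<in> extension (bracket_power R I (p ^ e))"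
        by (subst image_mem_extension_iff[OF R.ideal_bracket_power[OF I]]) (use mem that cc z in auto)
      then show ?thesis unfolding bracket_power_extension[OF I] using cc z by simp
    qed
    then have "\<phi> z \<in> tight_closure p A (extension I)"
      unfolding tight_closure_def circA using image_nonzerodivisor[OF c] z by auto
    then have "\<phi> z \<in> extension I"
      using wfr ideal_extension[OF I] unfolding weakly_F_regular_def by blast
    then show "\<exists>s\<in>S. s \<otimes> z \<in> I" using image_mem_extension_iff[OF I z] by simp
  qed
next
  interpret NA: noetherian_cring A
    by (intro noetherian_cring.intro noetherian_target[OF noeth] A.is_cring)
  have circA: "ring_circ A = nonzerodivisors A" by (rule NA.ring_circ_reduced[OF reduced_target[OF red]])
  assume at: "weakly_F_regular_at p R S"
  show "weakly_F_regular p A"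
    unfolding weakly_F_regular_def
  proof (intro allI impI equalityI subsetI)
    fix J z' assume J: "ideal J A" and "z' \<in> tight_closure p A J"
    then obtain c' e\<^sub>0 where z': "z' \<in> carrier A" and c': "c' \<in> nonzerodivisors A"
      and mem: "\<And>e. e \<ge> e\<^sub>0 \<Longrightarrow> c' \<otimes>\<^bsub>A\<^esub> z' [^]\<^bsub>A\<^esub> (p ^ e) \<in> bracket_power A J (p ^ e)"
      unfolding tight_closure_def circA by blast
    have cc': "c' \<in> carrier A" using c' unfolding nonzerodivisors_def by simp
    let ?I = "contraction J"
    have I: "ideal ?I R" by (rule ideal_contraction[OF J])
    obtain s z where s: "s \<in> S" "z \<in> carrier R" "\<phi> s \<otimes>\<^bsub>A\<^esub> z' = \<phi> z" using fractions[OF z'] by blast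
    obtain c t where c: "c \<in> nonzerodivisors R" "t \<in> S" "\<phi> t \<otimes>\<^bsub>A\<^esub> c' = \<phi> c"
      by (rule lift_nonzerodivisor[OF noeth red c'])
    have cc: "c \<in> carrier R" using c unfolding nonzerodivisors_def by simp
    have "\<exists>u\<in>S. u \<otimes> (c \<otimes> z [^] (p ^ e)) \<in> bracket_power R ?I (p ^ e)" if "e \<ge> e\<^sub>0" for e
    proof -
      let ?q = "p ^ e"
      have B: "ideal (bracket_power A J ?q) A" by (rule A.ideal_bracket_power[OF J])
      have "\<phi> (c \<otimes> z [^] ?q) = (\<phi> t \<otimes>\<^bsub>A\<^esub> c') \<otimes>\<^bsub>A\<^esub> (\<phi> s \<otimes>\<^bsub>A\<^esub> z') [^]\<^bsub>A\<^esub> ?q"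
        unfolding c(3) s(3) using cc s(2) by simp
      also have "\<dots> = (\<phi> t \<otimes>\<^bsub>A\<^esub> \<phi> s [^]\<^bsub>A\<^esub> ?q) \<otimes>\<^bsub>A\<^esub> (c' \<otimes>\<^bsub>A\<^esub> z' [^]\<^bsub>A\<^esub> ?q)"
        using c(2) s(1) cc' z' by (simp add: A.nat_pow_distrib A.m_ac)
      also have "\<dots> \<in> bracket_power A J ?q"
        by (rule A.ideal_props(4)[OF B _ mem[OF that]]) (use c(2) s(1) in simp)
      finally have "\<phi> (c \<otimes> z [^] ?q) \<in> extension (bracket_power R ?I ?q)"
        unfolding bracket_power_extension[OF I, symmetric] extension_contraction[OF J] .
      then show ?thesis
        using image_mem_extension_iff[OF R.ideal_bracket_power[OF I], of "c \<otimes> z [^] ?q"] cc s(2) by simp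
    qed
    then have "\<exists>u\<in>S. u \<otimes> z \<in> ?I" by (intro weakly_F_regular_atD[OF at I s(2) c(1), of e\<^sub>0]) blast
    then have "\<phi> z \<in> extension ?I" using image_mem_extension_iff[OF I s(2)] by simp
    then have "\<phi> s \<otimes>\<^bsub>A\<^esub> z' \<in> J" unfolding extension_contraction[OF J] s(3) .
    then show "z' \<in> J" by (rule unit_cancel_ideal[OF J s(1) z'])
  next
    fix J z' assume "ideal J A" "z' \<in> J"
    then show "z' \<in> tight_closure p A J" using A.subset_tight_closure by blast
  qed
qed

end

section \<open>Descent from maximal ideals to all primes\<close>

context noetherian_cring
begin

text \<open>
  The hypothesis on local rings applies to a copy of \<open>R\<^sub>Q\<close> inside the type of \<open>R\<close>, and a localization
  of that copy at the powers of one element is again a localization of \<open>R\<close>.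
\<close>

lemma weakly_F_regular_at_invert_element:
  assumes hyp: "\<forall>A :: 'a ring. noetherian_ring A \<and> Fp_algebra p A \<and> local_ring A \<and> weakly_F_regular p A
           \<longrightarrow> semi_F_regular p A"
    and red: "reduced_ring R" and Fp: "Fp_algebra p R"
    and Q: "primeideal Q R" and good: "weakly_F_regular_at p R (carrier R - Q)"
    and x: "x \<in> carrier R"
  shows "weakly_F_regular_at p R {t \<otimes> x [^] (n::nat) | t n. t \<in> carrier R - Q}"
proof -
  let ?S = "carrier R - Q"
  let ?L = "localization R ?S"
  interpret L: cring_mult_set R ?S
    by (intro cring_mult_set.intro is_cring submonoid_prime_complement[OF Q])
  interpret Lm: localization_map R ?L ?S "\<lambda>a. fraction R ?S a \<one>"
    by (rule L.localization_map_localization)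
  obtain g where g: "inj_on g (carrier ?L)" "g ` carrier ?L \<subseteq> carrier R"
    using Lm.target_lepoll unfolding lepoll_def by blast
  define A where "A = image_ring g ?L"
  define \<phi> where "\<phi> = g \<circ> (\<lambda>a. fraction R ?S a \<one>)"
  interpret A: localization_map R A ?S \<phi>
    unfolding A_def \<phi>_def by (rule Lm.localization_map_image_ring[OF g(1)])
  have "weakly_F_regular p A"
    by (rule A.weakly_F_regular_target_iff[OF noetherian_ring_axioms red, THEN iffD2, OF good])
  then have "semi_F_regular p A"
    by (intro hyp[THEN spec, THEN mp] conjI A.noetherian_target[OF noetherian_ring_axioms]
        A.Fp_algebra_target[OF Fp] A.local_target[OF Q refl])
  then have wfr: "weakly_F_regular p (localization A {\<phi> x [^]\<^bsub>A\<^esub> (n::nat) | n. True})"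
    unfolding semi_F_regular_def by (rule bspec) (rule A.\<phi>.hom_closed[OF x])
  interpret B: cring_mult_set A "{\<phi> x [^]\<^bsub>A\<^esub> (n::nat) | n. True}"
    by (intro cring_mult_set.intro A.A.is_cring A.A.submonoid_powers) (use x in simp)
  interpret B: localization_map R "localization A {\<phi> x [^]\<^bsub>A\<^esub> (n::nat) | n. True}"
    "{t \<otimes> x [^] (n::nat) | t n. t \<in> ?S}"
    "(\<lambda>a. fraction A {\<phi> x [^]\<^bsub>A\<^esub> (n::nat) | n. True} a \<one>\<^bsub>A\<^esub>) \<circ> \<phi>"
    by (rule A.localization_map_powers[OF x B.localization_map_localization])
  show ?thesis by (rule B.weakly_F_regular_target_iff[OF noetherian_ring_axioms red, THEN iffD1, OF wfr])
qed

text \<open>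
  A maximal prime \<open>P\<close> at which weak F-regularity fails is not a maximal ideal. Take \<open>x\<close> outside \<open>P\<close>
  with \<open>P + (x)\<close> proper and a prime \<open>Q\<close> minimal over \<open>P + (x)\<close>. Weak F-regularity holds at \<open>Q\<close>, so it survives
  inverting \<open>x\<close> in \<open>R\<^sub>Q\<close>; and there \<open>P\<close> becomes a maximal ideal by the principal ideal theorem.
\<close>

lemma weakly_F_regular_at_all_primes:
  assumes hyp: "\<forall>A :: 'a ring. noetherian_ring A \<and> Fp_algebra p A \<and> local_ring A \<and> weakly_F_regular p A
           \<longrightarrow> semi_F_regular p A"
    and red: "reduced_ring R" and Fp: "Fp_algebra p R" and wfr: "weakly_F_regular p R"
    and P: "primeideal P R"
  shows "weakly_F_regular_at p R (carrier R - P)"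
proof (rule ccontr)
  assume bad: "\<not> weakly_F_regular_at p R (carrier R - P)"
  define F where "F = {P. primeideal P R \<and> \<not> weakly_F_regular_at p R (carrier R - P)}"
  have PF: "P \<in> F" using P bad unfolding F_def by simp
  have "\<exists>M\<in>F. \<forall>J\<in>F. M \<subseteq> J \<longrightarrow> J = M"
    by (rule exists_maximal_ideal_in_family) (use PF prime_props(1) in \<open>auto simp: F_def\<close>)
  then obtain M where MF: "M \<in> F" and Mmax: "\<forall>J\<in>F. M \<subseteq> J \<longrightarrow> J = M" by (rule bexE)
  then have M: "primeideal M R" "\<not> weakly_F_regular_at p R (carrier R - M)" unfolding F_def by auto
  note idM = prime_props(1)[OF M(1)]
  show False
  proof (cases "\<exists>x\<in>carrier R - M. \<one> \<notin> adjoin M x")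
    case True
    then obtain x where x: "x \<in> carrier R" "x \<notin> M" "\<one> \<notin> adjoin M x" by blast
    note ad = ideal_adjoin[OF idM x(1)]
    obtain P0 where P0: "primeideal P0 R" "adjoin M x \<subseteq> P0" by (rule exists_prime_over[OF ad x(3)])
    obtain Q where Q: "primeideal Q R" "adjoin M x \<subseteq> Q"
      "\<And>P'. primeideal P' R \<Longrightarrow> adjoin M x \<subseteq> P' \<Longrightarrow> P' \<subseteq> Q \<Longrightarrow> P' = Q"
      using exists_prime_minimal_over[OF P0] by auto
    have MQ: "M \<subseteq> Q" using subset_adjoin[OF idM x(1)] Q(2) by (rule subset_trans)
    have xQ: "x \<in> Q" using mem_adjoin_self[OF idM x(1)] Q(2) by (rule subsetD[rotated])
    have "Q \<notin> F" using Mmax MQ xQ x(2) by auto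
    then have good: "weakly_F_regular_at p R (carrier R - Q)" using Q(1) unfolding F_def by simp
    define T where "T = {t \<otimes> x [^] (n::nat) | t n. t \<in> carrier R - Q}"
    have T: "submonoid T R"
      unfolding T_def by (rule submonoid_times_powers[OF submonoid_prime_complement[OF Q(1)] x(1)])
    have atT: "weakly_F_regular_at p R T"
      unfolding T_def by (rule weakly_F_regular_at_invert_element[OF hyp red Fp Q(1) good x(1)])
    have disj: "M \<inter> T = {}"
    proof (rule ccontr)
      assume "M \<inter> T \<noteq> {}"
      then obtain t n where t: "t \<in> carrier R" "t \<notin> Q" "t \<otimes> x [^] (n::nat) \<in> M" unfolding T_def by auto
      then have "t \<in> M \<or> x [^] n \<in> M" using prime_props(3)[OF M(1)] x(1) by simp
      then show False using t(2) MQ prime_power[OF M(1) x(1)] x(2) by auto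
    qed
    have "weakly_F_regular_at p R (carrier R - M)"
    proof (rule weakly_F_regular_at_maximal_prime[OF T atT M(1) disj])
      fix s assume s: "s \<in> carrier R - M"
      have min: "P' = Q" if "primeideal P' R" "M \<subseteq> P'" "x \<in> P'" "P' \<subseteq> Q" for P'
        by (rule Q(3)[OF that(1) adjoin_subset[OF prime_props(1)[OF that(1)] that(2,3)] that(4)])
      obtain t n where t: "t \<in> carrier R - Q" "t \<otimes> x [^] (n::nat) \<in> adjoin M s"
        using principal_ideal_theorem[OF M(1) Q(1) xQ min] s by blast
      show "\<exists>t\<in>T. t \<in> adjoin M s" unfolding T_def using t by blast
    qed
    then show False using M(2) by simp
  next
    case False
    interpret self: localization_map R R "{\<one>}" id by (rule localization_map_self)
    have at1: "weakly_F_regular_at p R {\<one>}"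
      using self.weakly_F_regular_target_iff[OF noetherian_ring_axioms red] wfr by simp
    have "weakly_F_regular_at p R (carrier R - M)"
      by (rule weakly_F_regular_at_maximal_prime[OF self.S.submonoid_axioms at1 M(1)])
        (use False prime_props(2)[OF M(1)] in auto)
    then show False using M(2) by simp
  qed
qed

lemma F_regular_of_weakly_F_regular:
  assumes hyp: "\<forall>A :: 'a ring. noetherian_ring A \<and> Fp_algebra p A \<and> local_ring A \<and> weakly_F_regular p A
           \<longrightarrow> semi_F_regular p A"
    and p: "p \<ge> 2" and Fp: "Fp_algebra p R" and wfr: "weakly_F_regular p R"
  shows "F_regular p R"
  unfolding F_regular_def
proof (intro allI impI)
  fix S assume S: "submonoid S R"
  have red: "reduced_ring R" by (rule reduced_of_weakly_F_regular[OF p wfr])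
  interpret L: cring_mult_set R S by (intro cring_mult_set.intro is_cring S)
  interpret L: localization_map R "localization R S" S "\<lambda>a. fraction R S a \<one>"
    by (rule L.localization_map_localization)
  have "weakly_F_regular_at p R S"
    by (rule weakly_F_regular_at_from_primes[OF S weakly_F_regular_at_all_primes[OF hyp red Fp wfr]])
  then show "weakly_F_regular p (localization R S)"
    using L.weakly_F_regular_target_iff[OF noetherian_ring_axioms red] by simp
qed

text \<open>
  Comparing \<open>R\<close> with its localization at \<open>{1}\<close> through \<open>weakly_F_regular_at\<close> presupposes that \<open>R\<close> is
  reduced; this is inherited from the localization, into which \<open>R\<close> embeds.
\<close>

lemma weakly_F_regular_of_F_regular:
  assumes p: "p \<ge> 2" and F: "F_regular p R"
  shows "weakly_F_regular p R"
proof -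
  interpret self: localization_map R R "{\<one>}" id by (rule localization_map_self)
  interpret L: cring_mult_set R "{\<one>}" by (intro cring_mult_set.intro is_cring self.S.submonoid_axioms)
  let ?L = "localization R {\<one>}"
  interpret L: localization_map R ?L "{\<one>}" "\<lambda>a. fraction R {\<one>} a \<one>"
    by (rule L.localization_map_localization)
  have wfr: "weakly_F_regular p ?L" using F self.S.submonoid_axioms unfolding F_regular_def by blast
  have redL: "reduced_ring ?L" by (rule L.A.reduced_of_weakly_F_regular[OF p wfr])
  have red: "reduced_ring R"
    unfolding reduced_ring_def
  proof (intro ballI allI impI)
    fix x n assume x: "x \<in> carrier R" "x [^] (n::nat) = \<zero>"
    have "fraction R {\<one>} x \<one> [^]\<^bsub>?L\<^esub> n = \<zero>\<^bsub>?L\<^esub>"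
      using L.image_power[OF x(1), of n] x(2) L.\<phi>.hom_zero by simp
    then have "fraction R {\<one>} x \<one> = \<zero>\<^bsub>?L\<^esub>"
      using redL L.\<phi>.hom_closed[OF x(1)] unfolding reduced_ring_def by blast
    then show "x = \<zero>" using L.kernel[OF x(1)] x(1) by simp
  qed
  have "weakly_F_regular_at p R {\<one>}"
    using L.weakly_F_regular_target_iff[OF noetherian_ring_axioms red] wfr by simp
  then show ?thesis using self.weakly_F_regular_target_iff[OF noetherian_ring_axioms red] by simp
qed

end

theorem proposition4p21:
  fixes p :: nat
  assumes "Factorial_Ring.prime p"
    and "\<forall>A :: 'a ring. noetherian_ring A \<and> Fp_algebra p A \<and> local_ring A \<and> weakly_F_regular p A
           \<longrightarrow> semi_F_regular p A"
  shows "\<forall>R :: 'a ring. noetherian_ring R \<and> Fp_algebra p R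
           \<longrightarrow> (weakly_F_regular p R \<longleftrightarrow> F_regular p R)"
proof (intro allI impI)
  fix R :: "'a ring"
  assume R: "noetherian_ring R \<and> Fp_algebra p R"
  then interpret noetherian_cring R
    unfolding Fp_algebra_def by (intro noetherian_cring.intro) auto
  have p: "p \<ge> 2" by (rule prime_ge_2_nat[OF assms(1)])
  show "weakly_F_regular p R \<longleftrightarrow> F_regular p R"
    using F_regular_of_weakly_F_regular[OF assms(2) p] weakly_F_regular_of_F_regular[OF p] R by blast
qed

end
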